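(* Let $(T_m,T_M)$ be the interval of definition of the maximal solution of the Cauchy problem $(H\text{-}SD)$ $$\dot x(t)+\nabla_Hf_{|\mathcal{F}}(x(t))=0,\quad x(0)=x^0\in\mathcal{F}.$$ Let $x\in W^{1,1}_{loc}(T_m,T_M;\mathbb{R}^n)$. Then $x$ is a solution of the differential inclusion problem $$\frac{d}{dt}\nabla h(x(t))+\nabla f(x(t))\in\mathcal{A}_0^\perp\ \text{ on }(T_m,T_M),\qquad x(t)\in\mathcal{F}\ \text{ on }(T_m,T_M),\qquad x(0)=x^0$$ (the inclusions being satisfied for almost every $t\in(T_m,T_M)$) if and only if $x$ is the solution of $(H\text{-}SD)$. In particular, the differential inclusion problem admits a unique solution, and it is of class $\mathcal{C}^1$.
   Context: Let $m<n$ be positive integers, $A\in\mathbb{R}^{m\times n}$ of full rank, $b\in\operatorname{Im}A$, $\mathcal{A}=\{x\in\mathbb{R}^n: Ax=b\}$, $\mathcal{A}_0=\ker A$, $\mathcal{A}_0^\perp=\operatorname{Im}A^T$. Let $C\subset\mathbb{R}^n$ be nonempty, open and convex, with $\mathcal{F}=C\cap\mathcal{A}\neq\emptyset$. The function $f\in\mathcal{C}^1(\mathbb{R}^n)$ has locally Lipschitz continuous gradient $\nabla f$ on $\mathbb{R}^n$. $\Gamma_0(\mathbb{R}^n)$ is the set of lower semicontinuous proper convex functions $\mathbb{R}^n\to\mathbb{R}\cup\{+\infty\}$. A function $h\in\Gamma_0(\mathbb{R}^n)$ is essentially smooth if it is differentiable on $\operatorname{int}\operatorname{dom}h$ and $|\nabla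 h(x^j)|\to+\infty$ for every sequence $(x^j)\subset\operatorname{int}\operatorname{dom}h$ converging to a boundary point of $\operatorname{dom}h$; it is of Legendre type if moreover it is strictly convex on $\operatorname{int}\operatorname{dom}h$. The function $h\in\Gamma_0(\mathbb{R}^n)$ is assumed to satisfy: (i) $h$ is of Legendre type with $\operatorname{int}\operatorname{dom}h=C$; (ii) $h_{|C}\in\mathcal{C}^2(C;\mathbb{R})$ and $\nabla^2h(x)$ is symmetric positive definite for all $x\in C$; (iii) $x\mapsto\nabla^2h(x)$ is locally Lipschitz continuous on $C$. Set $H=\nabla^2h$ on $C$. On the submanifold $\mathcal{F}$, with tangent space $\mathcal{A}_0$, consider the Riemannian metric $(u,v)^H_x=\langle H(x)u,v\rangle$; the gradient of $f_{|\mathcal{F}}$ for this metric is $$\nabla_Hf_{|\mathcal{F}}(x)=H(x)^{-1}\big[I-A^T(AH(x)^{-1}A^T)^{-1}AH(x)^{-1}\big]\nabla f(x),\quad x\in\mathcal{F}.$$ *)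

theory Defs
  imports "HOL-Analysis.Analysis"
begin

section \<open>Gradients, Hessians and smoothness classes\<close>

text \<open>For functions \<open>h\<close> with values in \<open>ereal\<close>, gradients and Hessians are those of
  \<open>\<lambda>x. real_of_ereal (h x)\<close>. They are only meaningful on the interior of the effective domain,
  and only used there.\<close>

definition grad :: "('a::real_inner \<Rightarrow> real) \<Rightarrow> 'a \<Rightarrow> 'a" where
  "grad g x = (THE D. GDERIV g x :> D)"

lemma grad_eqI:
  assumes "GDERIV g x :> D"
  shows "grad g x = D"
  unfolding grad_def
proof (rule the_equality)
  fix D' assume "GDERIV g x :> D'"
  with assms have "(\<lambda>h. h \<bullet> D') = (\<lambda>h. h \<bullet> D)"
    unfolding gderiv_def by (rule has_derivative_unique[rotated])
  then have "(D' - D) \<bullet> (D' - D) = 0"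
    by (metis inner_diff_right right_minus_eq)
  then show "D' = D" by simp
qed (fact assms)

definition hess :: "(real^'n \<Rightarrow> real) \<Rightarrow> real^'n \<Rightarrow> real^'n^'n" where
  "hess g x = jacobian (grad g) (at x)"

definition C1_on :: "(real^'n) set \<Rightarrow> (real^'n \<Rightarrow> real) \<Rightarrow> bool" where
  "C1_on S g \<longleftrightarrow> (\<forall>x\<in>S. g differentiable (at x)) \<and> continuous_on S (grad g)"

definition C2_on :: "(real^'n) set \<Rightarrow> (real^'n \<Rightarrow> real) \<Rightarrow> bool" where
  "C2_on S g \<longleftrightarrow> C1_on S g \<and> (\<forall>x\<in>S. grad g differentiable (at x)) \<and> continuous_on S (hess g)"

text \<open>The library notion \<open>local_lipschitz\<close> is for functions with a time parameter, which is
  irrelevant here.\<close>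

definition locally_lipschitz_on ::
  "'a::metric_space set \<Rightarrow> ('a \<Rightarrow> 'b::metric_space) \<Rightarrow> bool" where
  "locally_lipschitz_on S g \<longleftrightarrow> local_lipschitz (UNIV :: real set) S (\<lambda>_. g)"

definition sym_pos_def :: "real^'n^'n \<Rightarrow> bool" where
  "sym_pos_def M \<longleftrightarrow> transpose M = M \<and> (\<forall>u. u \<noteq> 0 \<longrightarrow> 0 < (M *v u) \<bullet> u)"


section \<open>Convex functions with values in \<open>\<real> \<union> {+\<infinity>}\<close>\<close>

definition eff_dom :: "('a \<Rightarrow> ereal) \<Rightarrow> 'a set" where
  "eff_dom h = {x. h x < \<infinity>}"

definition Gamma0 :: "('a::euclidean_space \<Rightarrow> ereal) set" where
  "Gamma0 = {h.
     (\<forall>x. h x \<noteq> -\<infinity>) \<and> eff_dom h \<noteq> {} \<and>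
     (\<forall>x. h x \<le> Liminf (nhds x) h) \<and>
     (\<forall>x y u. 0 < u \<and> u < 1 \<longrightarrow>
        h ((1 - u) *\<^sub>R x + u *\<^sub>R y) \<le> ereal (1 - u) * h x + ereal u * h y)}"

definition essentially_smooth :: "('a::euclidean_space \<Rightarrow> ereal) \<Rightarrow> bool" where
  "essentially_smooth h \<longleftrightarrow>
     (\<forall>x\<in>interior (eff_dom h). (\<lambda>y. real_of_ereal (h y)) differentiable (at x)) \<and>
     (\<forall>X z. (\<forall>j::nat. X j \<in> interior (eff_dom h)) \<and> z \<in> frontier (eff_dom h) \<and> X \<longlonglongrightarrow> z \<longrightarrow>
        filterlim (\<lambda>j. norm (grad (\<lambda>y. real_of_ereal (h y)) (X j))) at_top sequentially)"

definition strictly_convex_on :: "'a::real_vector set \<Rightarrow> ('a \<Rightarrow> real) \<Rightarrow> bool" where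
  "strictly_convex_on S g \<longleftrightarrow> convex S \<and>
     (\<forall>x\<in>S. \<forall>y\<in>S. \<forall>u. x \<noteq> y \<and> 0 < u \<and> u < 1 \<longrightarrow>
        g ((1 - u) *\<^sub>R x + u *\<^sub>R y) < (1 - u) * g x + u * g y)"

definition legendre_type :: "('a::euclidean_space \<Rightarrow> ereal) \<Rightarrow> bool" where
  "legendre_type h \<longleftrightarrow> essentially_smooth h \<and>
     strictly_convex_on (interior (eff_dom h)) (\<lambda>y. real_of_ereal (h y))"


section \<open>The Hessian Riemannian gradient on the affine constraint\<close>

definition feasible_set :: "(real^'n) set \<Rightarrow> real^'n^'m \<Rightarrow> real^'m \<Rightarrow> (real^'n) set" where
  "feasible_set C A b = C \<inter> {x. A *v x = b}"

definition HR_grad ::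
  "real^'n^'m \<Rightarrow> (real^'n \<Rightarrow> real^'n^'n) \<Rightarrow> (real^'n \<Rightarrow> real) \<Rightarrow> real^'n \<Rightarrow> real^'n" where
  "HR_grad A H f x =
     (matrix_inv (H x) **
       (mat 1 - transpose A ** matrix_inv (A ** matrix_inv (H x) ** transpose A) **
                A ** matrix_inv (H x))) *v grad f x"

text \<open>\<open>HR_grad\<close> is the Riemannian gradient of the restriction of \<open>f\<close> to the feasible set, for the
  metric \<open>(u, v) \<mapsto> \<langle>H x u, v\<rangle>\<close>: it is tangent and represents the differential of \<open>f\<close>
  along the tangent space \<open>ker A\<close>.\<close>

lemma sym_pos_def_invertible:
  assumes "sym_pos_def M"
  shows "invertible M"
proof -
  have "M *v u = 0 \<Longrightarrow> u = 0" for u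
    using assms unfolding sym_pos_def_def by (metis inner_zero_left less_irrefl)
  then show ?thesis
    by (simp add: invertible_left_inverse matrix_left_invertible_ker)
qed

lemma matrix_inv_mult:
  fixes M :: "real^'n^'n"
  assumes "invertible M"
  shows "M *v (matrix_inv M *v u) = u" "matrix_inv M *v (M *v u) = u"
proof -
  have "M ** matrix_inv M = mat 1 \<and> matrix_inv M ** M = mat 1"
    using assms unfolding invertible_def matrix_inv_def by (rule someI_ex)
  then show "M *v (matrix_inv M *v u) = u" "matrix_inv M *v (M *v u) = u"
    by (simp_all add: matrix_vector_mul_assoc)
qed

lemma HR_grad_riemannian:
  fixes A :: "real^'n^'m"
  assumes A: "rank A = CARD('m)" and H: "sym_pos_def (H x)"
  shows "A *v HR_grad A H f x = 0"
    and "A *v v = 0 \<Longrightarrow> (H x *v HR_grad A H f x) \<bullet> v = grad f x \<bullet> v"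
proof -
  define K where "K = matrix_inv (H x)"
  define S where "S = A ** K ** transpose A"
  have invH: "invertible (H x)" using H by (rule sym_pos_def_invertible)
  note HK = matrix_inv_mult[OF invH, folded K_def]
  have "u = 0" if "S *v u = 0" for u
  proof -
    define w where "w = transpose A *v u"
    have "A *v (K *v w) = 0"
      using that by (simp only: S_def w_def matrix_vector_mul_assoc matrix_mul_assoc)
    then have "(K *v w) \<bullet> w = 0"
      by (metis dot_lmul_matrix inner_commute inner_zero_right transpose_matrix_vector w_def)
    then have "(H x *v (K *v w)) \<bullet> (K *v w) = 0"
      by (simp add: HK inner_commute)
    then have "K *v w = 0"
      using H unfolding sym_pos_def_def by (metis less_irrefl)
    then have "w = 0" by (metis HK(1) matrix_vector_mult_0_right)
    moreover have "inj ((*v) (transpose A))"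
      using A by (simp add: full_rank_injective[symmetric] rank_transpose)
    ultimately show "u = 0"
      unfolding w_def by (metis injD matrix_vector_mult_0_right)
  qed
  then have "invertible S"
    by (simp add: invertible_left_inverse matrix_left_invertible_ker)
  note SI = matrix_inv_mult[OF this]
  define g where "g = grad f x"
  define q where "q = matrix_inv S *v (A *v (K *v g))"
  have G: "HR_grad A H f x = K *v (g - transpose A *v q)"
    unfolding HR_grad_def K_def[symmetric] S_def[symmetric] g_def[symmetric] q_def
    by (simp add: matrix_vector_mul_assoc[symmetric] matrix_vector_mult_diff_rdistrib)
  have "A *v (K *v (transpose A *v q)) = S *v q"
    by (simp only: S_def matrix_vector_mul_assoc matrix_mul_assoc)
  also have "\<dots> = A *v (K *v g)" unfolding q_def by (rule SI)
  finally show "A *v HR_grad A H f x = 0"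
    unfolding G by (simp add: matrix_vector_mult_diff_distrib)
  assume v: "A *v v = 0"
  have "(transpose A *v q) \<bullet> v = q \<bullet> (A *v v)"
    by (metis dot_lmul_matrix transpose_matrix_vector)
  then show "(H x *v HR_grad A H f x) \<bullet> v = grad f x \<bullet> v"
    unfolding G HK(1) using v by (simp add: inner_diff_left g_def)
qed


section \<open>The Cauchy problem and its maximal solution\<close>

text \<open>The time intervals are \<open>(a, b) = einterval a b\<close> with \<open>-\<infinity> \<le> a < 0 < b \<le> +\<infinity>\<close>; only the
  values of \<open>y\<close> on this interval matter. The vector field lives on the feasible set \<open>F\<close>, so
  solutions have to stay in \<open>F\<close>.\<close>

definition cauchy_solution ::
  "(real^'n) set \<Rightarrow> (real^'n \<Rightarrow> real^'n) \<Rightarrow> real^'n \<Rightarrow> ereal \<Rightarrow> ereal \<Rightarrow> (real \<Rightarrow> real^'n) \<Rightarrow> bool" where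
  "cauchy_solution F V x0 a b y \<longleftrightarrow> a < 0 \<and> 0 < b \<and> y 0 = x0 \<and>
     (\<forall>t\<in>einterval a b. y t \<in> F \<and>
        (\<exists>y'. (y has_vector_derivative y') (at t) \<and> y' + V (y t) = 0))"

definition maximal_cauchy_solution ::
  "(real^'n) set \<Rightarrow> (real^'n \<Rightarrow> real^'n) \<Rightarrow> real^'n \<Rightarrow> ereal \<Rightarrow> ereal \<Rightarrow> (real \<Rightarrow> real^'n) \<Rightarrow> bool" where
  "maximal_cauchy_solution F V x0 a b y \<longleftrightarrow> cauchy_solution F V x0 a b y \<and>
     (\<forall>a' b' z. cauchy_solution F V x0 a' b' z \<and> a' \<le> a \<and> b \<le> b' \<and>
        (\<forall>t\<in>einterval a b. z t = y t) \<longrightarrow> a' = a \<and> b' = b)"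


section \<open>\<open>W\<^sup>1\<^sup>,\<^sup>1\<close>-functions on an open interval and the differential inclusion\<close>

definition locally_integrable_on ::
  "(real \<Rightarrow> 'a::euclidean_space) \<Rightarrow> real set \<Rightarrow> bool" where
  "locally_integrable_on u J \<longleftrightarrow> (\<forall>K. compact K \<and> K \<subseteq> J \<longrightarrow> u absolutely_integrable_on K)"

definition test_function :: "real set \<Rightarrow> (real \<Rightarrow> real) \<Rightarrow> bool" where
  "test_function J \<phi> \<longleftrightarrow> \<phi> C1_differentiable_on UNIV \<and>
     (\<exists>K. compact K \<and> K \<subseteq> J \<and> (\<forall>t. t \<notin> K \<longrightarrow> \<phi> t = 0))"

definition has_weak_derivative_on ::
  "(real \<Rightarrow> 'a::euclidean_space) \<Rightarrow> (real \<Rightarrow> 'a) \<Rightarrow> real set \<Rightarrow> bool" where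
  "has_weak_derivative_on u v J \<longleftrightarrow> (\<forall>\<phi>. test_function J \<phi> \<longrightarrow>
     set_lebesgue_integral lebesgue J (\<lambda>t. deriv \<phi> t *\<^sub>R u t) =
     - set_lebesgue_integral lebesgue J (\<lambda>t. \<phi> t *\<^sub>R v t))"

text \<open>On an interval, every class of functions in \<open>W\<^sup>1\<^sup>,\<^sup>1\<close> has exactly one continuous
  representative; as usual the class is identified with it. This is what gives a meaning to
  pointwise values and to pointwise derivatives of compositions.\<close>

definition W11_loc :: "real set \<Rightarrow> (real \<Rightarrow> 'a::euclidean_space) set" where
  "W11_loc J = {u. continuous_on J u \<and> locally_integrable_on u J \<and>
     (\<exists>v. locally_integrable_on v J \<and> has_weak_derivative_on u v J)}"

definition inclusion_solution ::
  "(real^'n) set \<Rightarrow> real^'n^'m \<Rightarrow> real^'m \<Rightarrow> (real^'n \<Rightarrow> real) \<Rightarrow> (real^'n \<Rightarrow> ereal) \<Rightarrow>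
   real^'n \<Rightarrow> real set \<Rightarrow> (real \<Rightarrow> real^'n) \<Rightarrow> bool" where
  "inclusion_solution C A b f h x0 J x \<longleftrightarrow>
     (AE t\<in>J in lebesgue.
        \<exists>D. ((\<lambda>s. grad (\<lambda>y. real_of_ereal (h y)) (x s)) has_vector_derivative D) (at t) \<and>
            D + grad f (x t) \<in> range ((*v) (transpose A))) \<and>
     (AE t\<in>J in lebesgue. x t \<in> feasible_set C A b) \<and>
     x 0 = x0"

end

theory Submission
  imports Defs
begin

text \<open>
  Let \<open>V\<close> be the Riemannian gradient. A weakly differentiable curve \<open>x\<close> is the integral of its weak
  derivative, by testing with approximations of indicator functions. At almost every \<open>t\<close>, the curve
  \<open>\<nabla>h \<circ> x\<close> is differentiable and \<open>x t\<close> is feasible; since \<open>\<nabla>\<^sup>2h\<close> is invertible, \<open>x\<close> is then differentiable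
  at \<open>t\<close>, and \<open>x' = - V x\<close> because the inclusion and \<open>A x' = 0\<close> determine \<open>x'\<close>.

  Feasibility almost everywhere does not prevent \<open>x\<close> from touching the boundary of \<open>C\<close>. But the set where
  \<open>x\<close> agrees with the maximal solution is closed, and it is open: near a point of agreement \<open>x\<close> stays in
  \<open>C\<close>, where \<open>V\<close> is locally Lipschitz, so that \<open>x\<close> is a classical solution there and uniqueness for the
  Cauchy problem applies.
\<close>

section \<open>Curves with an almost everywhere derivative\<close>

text \<open>Truncation and outer regularity: cutting \<open>g\<close> at a large height
  \<open>k\<close> costs less than e/2 of the integral, and an open set of small measure around
  \<open>N\<close> carries at most e/2 of the part below \<open>k\<close>.\<close>

lemma integrable_small_on_open_superset:
  fixes g :: "real \<Rightarrow> real"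
  assumes g: "g integrable_on {a..b}" and pos: "\<And>t. t \<in> {a..b} \<Longrightarrow> 0 \<le> g t"
    and N: "negligible N" and e: "0 < e"
  obtains G where "open G" "N \<subseteq> G" "(\<lambda>t. if t \<in> G then g t else 0) integrable_on {a..b}"
    "integral {a..b} (\<lambda>t. if t \<in> G then g t else 0) < e"
proof -
  have ag: "g absolutely_integrable_on {a..b}"
    using g pos by (rule nonnegative_absolutely_integrable_1)
  have ak: "(\<lambda>t. min (g t) (real k)) absolutely_integrable_on {a..b}" for k
    by (rule absolutely_integrable_min_1[OF ag]) (simp add: absolutely_integrable_on_const)
  have ik: "(\<lambda>t. min (g t) (real k)) integrable_on {a..b}" for k
    using ak set_lebesgue_integral_eq_integral(1) by blast
  have "(\<lambda>k. integral {a..b} (\<lambda>t. min (g t) (real k))) \<longlonglongrightarrow> integral {a..b} g"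
  proof (rule dominated_convergence(2)[OF ik g])
    fix k t assume t: "t \<in> {a..b}"
    then show "norm (min (g t) (real k)) \<le> g t" using pos[OF t] by simp
  next
    fix t
    obtain n where "g t \<le> real n" using real_arch_simple by blast
    then have "\<forall>k\<ge>n. min (g t) (real k) = g t" by auto
    then show "(\<lambda>k. min (g t) (real k)) \<longlonglongrightarrow> g t"
      by (intro tendsto_eventually) (auto simp: eventually_sequentially)
  qed
  then have "\<forall>\<^sub>F k in sequentially. integral {a..b} g - e/2 < integral {a..b} (\<lambda>t. min (g t) (real k))"
    using e by (intro order_tendstoD) auto
  then obtain k where k: "integral {a..b} g - e/2 < integral {a..b} (\<lambda>t. min (g t) (real k))"
    using eventually_happens' sequentially_bot by blast
  have "N \<in> sets lebesgue" using N by (simp add: negligible_imp_sets)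
  \<comment> \<open>The summand 1 keeps the denominator positive when \<open>k\<close> is 0; k times
    this bound is still at most e/2.\<close>
  moreover have "0 < e / (2 * (real k + 1))" using e by simp
  ultimately obtain G where G: "open G" "N \<subseteq> G" "G - N \<in> lmeasurable"
      "emeasure lebesgue (G - N) < ennreal (e / (2 * (real k + 1)))"
    by (rule sets_lebesgue_outer_open)
  have Gm: "G \<in> lmeasurable"
    using G(2,3) N by (metis Diff_partition negligible_imp_measurable fmeasurable.Un)
  have "measure lebesgue G = measure lebesgue (G - N)"
    using N G(1) by (simp add: measure_Diff_null_set negligible_iff_null_sets borel_open)
  also have "\<dots> < e / (2 * (real k + 1))"
    using G(3,4) e by (simp add: emeasure_eq_measure2 ennreal_less_iff)
  finally have mG: "measure lebesgue G < e / (2 * (real k + 1))" .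
  let ?\<phi> = "\<lambda>t. if t \<in> G then g t else 0"
  have G_sets: "{a..b} \<inter> G \<in> sets lebesgue" using G(1) by (simp add: borel_open)
  have "?\<phi> absolutely_integrable_on {a..b}"
  proof -
    have "g absolutely_integrable_on {a..b} \<inter> G"
      using ag by (rule set_integrable_subset) (use G_sets in auto)
    then have "(\<lambda>t. if t \<in> {a..b} \<inter> G then g t else 0) absolutely_integrable_on UNIV"
      by (simp only: absolutely_integrable_restrict_UNIV)
    moreover have "(\<lambda>t. if t \<in> {a..b} \<inter> G then g t else 0) = (\<lambda>t. if t \<in> {a..b} then ?\<phi> t else 0)"
      by auto
    ultimately have "(\<lambda>t. if t \<in> {a..b} then ?\<phi> t else 0) absolutely_integrable_on UNIV"
      by simp
    then show ?thesis by (simp only: absolutely_integrable_restrict_UNIV)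
  qed
  then have i\<phi>: "?\<phi> integrable_on {a..b}" using set_lebesgue_integral_eq_integral(1) by blast
  have iG: "(indicat_real G) integrable_on UNIV" "integral UNIV (indicat_real G) = measure lebesgue G"
    using Gm by (auto simp: lmeasurable_iff_has_integral integral_unique integrable_on_def)
  have iGab: "indicat_real G integrable_on {a..b}"
    using iG(1) by (rule integrable_on_subinterval) simp
  \<comment> \<open>On \<open>G\<close> the excess of \<open>g\<close> over \<open>k\<close> plus
    \<open>k\<close> dominates \<open>g\<close>; off \<open>G\<close> the right-hand integrand is
    nonnegative.\<close>
  have "integral {a..b} ?\<phi> \<le> integral {a..b} (\<lambda>t. (g t - min (g t) (real k)) + real k * indicat_real G t)"
  proof (rule integral_le[OF i\<phi>])
    show "(\<lambda>t. (g t - min (g t) (real k)) + real k * indicat_real G t) integrable_on {a..b}"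
      by (intro integrable_add integrable_diff g ik integrable_on_mult_right iGab)
  qed (auto simp: min_def)
  also have "\<dots> = integral {a..b} (\<lambda>t. g t - min (g t) (real k)) + integral {a..b} (\<lambda>t. real k * indicat_real G t)"
    by (intro integral_add integrable_diff g ik integrable_on_mult_right iGab)
  also have "\<dots> = (integral {a..b} g - integral {a..b} (\<lambda>t. min (g t) (real k))) + real k * integral {a..b} (indicat_real G)"
    by (simp add: integral_diff[OF g ik])
  also have "\<dots> < e/2 + e/2"
  proof -
    have "integral {a..b} (indicat_real G) \<le> measure lebesgue G"
      unfolding iG(2)[symmetric] by (rule integral_subset_le) (auto intro: iG iGab)
    then have "real k * integral {a..b} (indicat_real G) \<le> real k * (e / (2 * (real k + 1)))"
      using mG by (intro mult_left_mono) auto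
    also have "\<dots> \<le> e/2" using e by (simp add: field_simps)
    finally show ?thesis using k by simp
  qed
  finally show thesis using that G(1,2) i\<phi> by simp
qed

text \<open>The exceptional null set is covered by an open set over which \<open>norm \<circ> w\<close> has integral below \<open>\<epsilon>\<close>; the
  increments of \<open>z\<close> are then controlled near every point, and bisection makes the bound global.\<close>

lemma indefinite_integral_const:
  fixes z w :: "real \<Rightarrow> 'a::euclidean_space"
  assumes ab: "a \<le> b" and w: "w absolutely_integrable_on {a..b}"
    and z: "\<And>s t. a \<le> s \<Longrightarrow> s \<le> t \<Longrightarrow> t \<le> b \<Longrightarrow> z t - z s = integral {s..t} w"
    and N: "negligible N"
    and deriv: "\<And>t. t \<in> {a..b} - N \<Longrightarrow> (z has_vector_derivative 0) (at t within {a..b})"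
  shows "z b = z a"
proof -
  have nw: "(\<lambda>t. norm (w t)) integrable_on {a..b}"
    using w absolutely_integrable_on_def by blast
  have "norm (z b - z a) \<le> \<epsilon> * (b - a) + \<epsilon>" if \<epsilon>: "0 < \<epsilon>" for \<epsilon>
  proof -
    obtain G where G: "open G" "N \<subseteq> G" "(\<lambda>t. if t \<in> G then norm (w t) else 0) integrable_on {a..b}"
        "integral {a..b} (\<lambda>t. if t \<in> G then norm (w t) else 0) < \<epsilon>"
      by (rule integrable_small_on_open_superset[OF nw _ N \<epsilon>]) auto
    define \<phi> where "\<phi> t = (if t \<in> G then norm (w t) else 0)" for t
    have i\<phi>: "\<phi> integrable_on {u..v}" if "a \<le> u" "v \<le> b" for u v
      using integrable_on_subinterval[OF G(3), of u v] that unfolding \<phi>_def by auto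
    have \<phi>0: "0 \<le> integral {u..v} \<phi>" if "a \<le> u" "v \<le> b" for u v
      by (rule integral_nonneg[OF i\<phi>[OF that]]) (auto simp: \<phi>_def)
    \<comment> \<open>The bound adds up over adjacent intervals, as bisection requires. The guard
      makes \<open>P\<close> vacuous for intervals that stick out of {a..b}, since the local case of
      \<open>Bolzano\<close> ranges over all small intervals around \<open>t\<close>.\<close>
    define P where "P u v \<longleftrightarrow> (a \<le> u \<and> u \<le> v \<and> v \<le> b \<longrightarrow>
      norm (z v - z u) \<le> \<epsilon> * (v - u) + integral {u..v} \<phi>)" for u v
    have "P a b"
      using ab
    proof (induction rule: Bolzano)
      case (trans u v y)
      show ?case
        unfolding P_def
      proof safe
        assume h: "a \<le> u" "u \<le> y" "y \<le> b"
        have "integral {u..v} \<phi> + integral {v..y} \<phi> = integral {u..y} \<phi>"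
          using trans h by (intro Henstock_Kurzweil_Integration.integral_combine i\<phi>) auto
        moreover have "norm (z y - z u) \<le> norm (z y - z v) + norm (z v - z u)"
          by (metis norm_triangle_ineq diff_add_cancel add_diff_eq)
        ultimately show "norm (z y - z u) \<le> \<epsilon> * (y - u) + integral {u..y} \<phi>"
          using trans h unfolding P_def by (simp add: algebra_simps)
      qed
    next
      case (local t)
      show ?case
      proof (cases "t \<in> N")
        \<comment> \<open>No derivative is available here, but a short interval around
          \<open>t\<close> lies in \<open>G\<close>, where \<phi> equals the norm of
          \<open>w\<close>.\<close>
        case True
        then obtain d where d: "0 < d" "\<And>s. \<bar>s - t\<bar> < d \<Longrightarrow> s \<in> G"
          using G(1,2) unfolding open_dist dist_real_def by blast
        have "P u v" if uv: "u \<le> t \<and> t \<le> v \<and> v - u < d" for u v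
          unfolding P_def
        proof safe
          assume h: "a \<le> u" "u \<le> v" "v \<le> b"
          have "norm (z v - z u) = norm (integral {u..v} w)" using z h by simp
          also have "\<dots> \<le> integral {u..v} \<phi>"
          proof (rule integral_norm_bound_integral[OF _ i\<phi>])
            show "w integrable_on {u..v}"
              using w h by (meson atLeastatMost_subset_iff integrable_on_subinterval set_lebesgue_integral_eq_integral(1))
            show "norm (w s) \<le> \<phi> s" if "s \<in> {u..v}" for s
              using that uv d(2)[of s] unfolding \<phi>_def by (auto simp: abs_less_iff)
          qed (use h in auto)
          finally show "norm (z v - z u) \<le> \<epsilon> * (v - u) + integral {u..v} \<phi>"
            using \<epsilon> h by (simp add: add_increasing)
        qed
        then show ?thesis using d(1) by blast
      next
        case False
        then have "(z has_vector_derivative 0) (at t within {a..b})"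
          using deriv local by simp
        then obtain d where d: "0 < d"
          "\<And>s. s \<in> {a..b} \<Longrightarrow> \<bar>s - t\<bar> < d \<Longrightarrow> norm (z s - z t) \<le> \<epsilon> * \<bar>s - t\<bar>"
          using \<epsilon> unfolding has_vector_derivative_def has_derivative_within_alt by auto
        have "P u v" if uv: "u \<le> t \<and> t \<le> v \<and> v - u < d" for u v
          unfolding P_def
        proof safe
          assume h: "a \<le> u" "u \<le> v" "v \<le> b"
          have "norm (z v - z u) \<le> norm (z v - z t) + norm (z u - z t)"
            by (metis norm_triangle_ineq4 diff_diff_eq2 diff_add_cancel add_diff_eq)
          also have "\<dots> \<le> \<epsilon> * \<bar>v - t\<bar> + \<epsilon> * \<bar>u - t\<bar>"
            using d(2)[of v] d(2)[of u] uv h by (intro add_mono) auto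
          also have "\<dots> = \<epsilon> * (v - u)" using uv by (simp add: algebra_simps)
          finally show "norm (z v - z u) \<le> \<epsilon> * (v - u) + integral {u..v} \<phi>"
            using \<phi>0 h by (simp add: add_increasing2)
        qed
        then show ?thesis using d(1) by blast
      qed
    qed
    then show ?thesis using ab G(4) unfolding P_def \<phi>_def by force
  qed
  note * = this
  have "norm (z b - z a) \<le> 0"
  proof (rule field_le_epsilon)
    fix e :: real assume "0 < e"
    \<comment> \<open>The choice \<epsilon> = e / (b - a + 1) makes the bound exactly e, also when a
      = b.\<close>
    then have "norm (z b - z a) \<le> e / (b - a + 1) * (b - a) + e / (b - a + 1)"
      using ab by (intro *) simp
    also have "\<dots> = e / (b - a + 1) * (b - a + 1)" by (simp only: distrib_left mult_1_right)
    also have "\<dots> = e" using ab by simp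
    finally show "norm (z b - z a) \<le> 0 + e" by simp
  qed
  then show ?thesis by simp
qed

text \<open>A primitive \<open>P\<close> of the continuous \<open>g\<close> differs from
  \<open>x\<close> by the indefinite integral of v - g, whose derivative vanishes off
  \<open>N\<close>. By \<open>indefinite_integral_const\<close> the difference is constant, so
  \<open>x\<close> inherits the derivative of \<open>P\<close> at every interior point.\<close>

lemma ae_derivative_imp_derivative:
  fixes x g v :: "real \<Rightarrow> 'a::euclidean_space"
  assumes v: "v absolutely_integrable_on {a..b}"
    and x: "\<And>s t. a \<le> s \<Longrightarrow> s \<le> t \<Longrightarrow> t \<le> b \<Longrightarrow> x t - x s = integral {s..t} v"
    and g: "continuous_on {a..b} g" and N: "negligible N"
    and D: "\<And>t. t \<in> {a..b} - N \<Longrightarrow> (x has_vector_derivative g t) (at t)"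
    and t: "t \<in> {a<..<b}"
  shows "(x has_vector_derivative g t) (at t)"
proof -
  define P where "P s = integral {a..s} g" for s
  have P: "(P has_vector_derivative g s) (at s within {a..b})" if "s \<in> {a..b}" for s
    unfolding P_def using integral_has_vector_derivative[OF g that] .
  have gi: "g absolutely_integrable_on {a..b}" by (rule absolutely_integrable_continuous_real[OF g])
  have vi: "v integrable_on {a..b}" "g integrable_on {a..b}"
    using v gi set_lebesgue_integral_eq_integral(1) by blast+
  have "x s - P s = x a - P a" if s: "s \<in> {a..b}" for s
  proof (rule indefinite_integral_const[where z="\<lambda>s. x s - P s" and w="\<lambda>s. v s - g s" and N=N])
    show "(\<lambda>s. v s - g s) absolutely_integrable_on {a..s}"
      using set_integral_diff(1)[OF v gi] s by (rule_tac absolutely_integrable_on_subinterval) auto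
    fix p q assume pq: "a \<le> p" "p \<le> q" "q \<le> s"
    have sub: "{p..q} \<subseteq> {a..b}" "{a..q} \<subseteq> {a..b}" using pq s by auto
    have "P q - P p = integral {p..q} g"
      using Henstock_Kurzweil_Integration.integral_combine[of a p q g]
        integrable_on_subinterval[OF vi(2) sub(2)] pq by (simp add: P_def algebra_simps)
    moreover have "integral {p..q} (\<lambda>s. v s - g s) = integral {p..q} v - integral {p..q} g"
      by (rule integral_diff) (use integrable_on_subinterval vi sub in blast)+
    ultimately show "x q - P q - (x p - P p) = integral {p..q} (\<lambda>s. v s - g s)"
      using x[of p q] pq s by (simp add: algebra_simps)
  next
    fix r assume r: "r \<in> {a..s} - N"
    have "(P has_vector_derivative g r) (at r within {a..s})"
      using P[of r] r s by (auto intro: has_vector_derivative_within_subset)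
    moreover have "(x has_vector_derivative g r) (at r within {a..s})"
      using D[of r] r s by (auto intro: has_vector_derivative_at_within)
    ultimately show "((\<lambda>s. x s - P s) has_vector_derivative 0) (at r within {a..s})"
      using has_vector_derivative_diff by fastforce
  qed (use s N in auto)
  then have eq: "P s + (x a - P a) = x s" if "s \<in> {a<..<b}" for s
    using that by (metis (no_types) add_diff_cancel_left' add_diff_eq diff_add_cancel
        greaterThanLessThan_iff atLeastAtMost_iff less_imp_le)
  have "(P has_vector_derivative g t) (at t)"
    using P[of t] t by (simp add: at_within_Icc_at)
  then have "((\<lambda>s. P s + (x a - P a)) has_vector_derivative g t) (at t)"
    by (simp add: has_vector_derivative_add_const)
  then show ?thesis
    by (rule has_vector_derivative_transform_within_open[of _ _ _ "{a<..<b}"]) (use t eq in auto)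
qed

text \<open>The exceptional set is open and null, hence empty.\<close>

lemma AE_eq_const_imp_eq:
  fixes g :: "'a::euclidean_space \<Rightarrow> 'b::t1_space"
  assumes J: "open J" and g: "continuous_on J g" and ae: "AE t\<in>J in lebesgue. g t = k" and t: "t \<in> J"
  shows "g t = k"
proof (rule ccontr)
  assume "g t \<noteq> k"
  define U where "U = J \<inter> g -` (- {k})"
  have "open U" unfolding U_def using J g by (intro continuous_open_preimage) auto
  moreover have "negligible U"
  proof -
    obtain N where N: "N \<in> null_sets lebesgue" "{t \<in> space lebesgue. \<not> (t \<in> J \<longrightarrow> g t = k)} \<subseteq> N"
      using ae unfolding eventually_ae_filter by blast
    have "U \<subseteq> N" using N(2) by (auto simp: U_def)
    then show ?thesis using N(1) negligible_iff_null_sets negligible_subset by blast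
  qed
  ultimately have "U = {}" using open_not_negligible by blast
  then show False using t \<open>g t \<noteq> k\<close> by (auto simp: U_def)
qed

section \<open>Weak derivatives\<close>

text \<open>Turns the Lebesgue integrals of the weak formulation, where test functions have compact
  support, into gauge integrals over an interval, to which the fundamental theorem applies.\<close>

lemma set_lebesgue_integral_eq_integral_interval:
  fixes g :: "real \<Rightarrow> 'a::euclidean_space"
  assumes g: "g absolutely_integrable_on {c..d}" and sub: "{c..d} \<subseteq> J"
    and zero: "\<And>t. t \<in> J - {c..d} \<Longrightarrow> g t = 0"
  shows "set_lebesgue_integral lebesgue J g = integral {c..d} g"
proof -
  have "(\<lambda>t. indicator J t *\<^sub>R g t) = (\<lambda>t. indicator {c..d} t *\<^sub>R g t)"
    using sub zero by (auto simp: fun_eq_iff indicator_def)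
  then have "set_lebesgue_integral lebesgue J g = set_lebesgue_integral lebesgue {c..d} g"
    unfolding set_lebesgue_integral_def by simp
  then show ?thesis using g by (simp add: set_lebesgue_integral_eq_integral(2))
qed

lemma absolutely_integrable_continuous_scaleR:
  fixes v :: "real \<Rightarrow> 'a::euclidean_space"
  assumes "continuous_on {a..b} \<psi>" "v absolutely_integrable_on {a..b}"
  shows "(\<lambda>t. \<psi> t *\<^sub>R v t) absolutely_integrable_on {a..b}"
proof (rule absolutely_integrable_bounded_measurable_product[OF bilinear_conv_bounded_bilinear[THEN iffD2, OF bounded_bilinear_scaleR]])
  show "\<psi> \<in> borel_measurable (lebesgue_on {a..b})"
    using assms(1) by (intro continuous_imp_measurable_on_sets_lebesgue) auto
  show "bounded (\<psi> ` {a..b})"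
    using assms(1) by (intro compact_imp_bounded compact_continuous_image) auto
qed (use assms(2) in auto)

text \<open>An explicit test function: \<open>spline_step\<close> is the \<open>C\<^sup>1\<close> quadratic spline that rises from \<open>0\<close> to \<open>1\<close>
  on \<open>[0, 1]\<close> with a knot at \<open>1/2\<close>, written with absolute values to avoid case distinctions.\<close>

definition spline_step :: "real \<Rightarrow> real" where
  "spline_step x = (x\<^sup>2 + x * \<bar>x\<bar>) - 2 * ((x - 1/2)\<^sup>2 + (x - 1/2) * \<bar>x - 1/2\<bar>) +
     ((x - 1)\<^sup>2 + (x - 1) * \<bar>x - 1\<bar>)"

text \<open>The hat function on [0, 1] with peak 2 at 1/2; it has mass 1 and is the derivative of
  \<open>spline_step\<close>.\<close>

definition spline_tent :: "real \<Rightarrow> real" where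
  "spline_tent x = 2 * (x + \<bar>x\<bar>) - 4 * (x - 1/2 + \<bar>x - 1/2\<bar>) + 2 * (x - 1 + \<bar>x - 1\<bar>)"

text \<open>This is what makes the spline C1 at its knots: each of its building blocks (x - c)^2 +
  (x - c) * |x - c| is twice the square of max (x - c) 0.\<close>

lemma DERIV_mult_abs: "((\<lambda>x::real. x * \<bar>x\<bar>) has_real_derivative 2 * \<bar>x\<bar>) (at x)"
proof (cases "x = 0")
  case True
  have "((\<lambda>h::real. \<bar>h\<bar>) \<longlongrightarrow> 0) (at 0)" by (rule tendsto_eq_intros refl | simp)+
  then have "((\<lambda>h::real. (h * \<bar>h\<bar>) / h) \<longlongrightarrow> 0) (at 0)"
    by (rule Lim_transform_eventually) (auto simp: eventually_at_filter)
  with True show ?thesis by (simp add: DERIV_def)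
next
  case False
  then consider "0 < x" | "x < 0" by linarith
  then show ?thesis
  proof cases
    case 1
    have "((\<lambda>x. x * x) has_real_derivative 2 * \<bar>x\<bar>) (at x)"
      using 1 by (auto intro!: derivative_eq_intros)
    then show ?thesis
      by (rule has_field_derivative_transform_within_open[where S="{0<..}"]) (use 1 in auto)
  next
    case 2
    have "((\<lambda>x. - (x * x)) has_real_derivative 2 * \<bar>x\<bar>) (at x)"
      using 2 by (auto intro!: derivative_eq_intros)
    then show ?thesis
      by (rule has_field_derivative_transform_within_open[where S="{..<0}"]) (use 2 in auto)
  qed
qed

lemma spline_step_deriv: "(spline_step has_real_derivative spline_tent x) (at x)"
proof -
  have *: "((\<lambda>x. (x - c)\<^sup>2 + (x - c) * \<bar>x - c\<bar>) has_real_derivative 2 * (x - c) + 2 * \<bar>x - c\<bar>) (at x)" for c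
  proof -
    have "((\<lambda>x. (x - c) * \<bar>x - c\<bar>) has_real_derivative 2 * \<bar>x - c\<bar> * 1) (at x)"
      by (rule DERIV_chain2[OF DERIV_mult_abs]) (auto intro!: derivative_eq_intros)
    then have "((\<lambda>x. (x - c) * \<bar>x - c\<bar>) has_real_derivative 2 * \<bar>x - c\<bar>) (at x)" by simp
    moreover have "((\<lambda>x. (x - c)\<^sup>2) has_real_derivative 2 * (x - c)) (at x)"
      by (auto intro!: derivative_eq_intros)
    ultimately show ?thesis by (intro DERIV_add)
  qed
  have "((\<lambda>x. ((x - 0)\<^sup>2 + (x - 0) * \<bar>x - 0\<bar>) - 2 * ((x - 1/2)\<^sup>2 + (x - 1/2) * \<bar>x - 1/2\<bar>) +
     ((x - 1)\<^sup>2 + (x - 1) * \<bar>x - 1\<bar>)) has_real_derivative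
     (2 * (x - 0) + 2 * \<bar>x - 0\<bar>) - 2 * (2 * (x - 1/2) + 2 * \<bar>x - 1/2\<bar>) + (2 * (x - 1) + 2 * \<bar>x - 1\<bar>)) (at x)"
    by (intro DERIV_add DERIV_diff DERIV_cmult *)
  then show ?thesis
    unfolding spline_step_def[abs_def] spline_tent_def by (simp add: algebra_simps)
qed

lemma spline_tent_cont: "continuous_on S spline_tent"
  unfolding spline_tent_def by (intro continuous_intros)

lemma spline_tent_nonneg: "0 \<le> spline_tent x"
  unfolding spline_tent_def by (auto simp: abs_real_def)

lemma spline_tent_zero: "x \<le> 0 \<or> 1 \<le> x \<Longrightarrow> spline_tent x = 0"
  unfolding spline_tent_def by (auto simp: abs_real_def)

lemma spline_step_zero: "x \<le> 0 \<Longrightarrow> spline_step x = 0"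
  unfolding spline_step_def by (auto simp: abs_real_def power2_eq_square algebra_simps)

lemma spline_step_one: "1 \<le> x \<Longrightarrow> spline_step x = 1"
  unfolding spline_step_def by (auto simp: abs_real_def power2_eq_square field_simps)

lemma spline_step_mono: "x \<le> y \<Longrightarrow> spline_step x \<le> spline_step y"
  using DERIV_nonneg_imp_nondecreasing spline_step_deriv spline_tent_nonneg by blast

lemma spline_step_bounds: "0 \<le> spline_step x" "spline_step x \<le> 1"
  using spline_step_mono[of "min x 0" x] spline_step_mono[of x "max x 1"]
  by (auto simp: spline_step_zero spline_step_one)

lemma spline_step_cont: "continuous_on S spline_step"
  using spline_step_deriv by (meson DERIV_continuous_on has_field_derivative_at_within)

lemma spline_step_scaled_deriv:
  "((\<lambda>t. spline_step (c * (t - p))) has_real_derivative c * spline_tent (c * (t - p))) (at t)"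
proof -
  have "((\<lambda>t. spline_step (c * (t - p))) has_real_derivative spline_tent (c * (t - p)) * c) (at t)"
    by (rule DERIV_chain2[OF spline_step_deriv]) (auto intro!: derivative_eq_intros)
  then show ?thesis by (simp add: mult.commute)
qed

section \<open>Limits of integrals against rescaled splines\<close>

text \<open>The rescaled steps have values in [0, 1] and tend pointwise to the indicator of (p,
  \<infinity>), so dominated convergence applies with bound norm v.\<close>

lemma spline_step_tendsto_integral:
  fixes v :: "real \<Rightarrow> 'a::euclidean_space"
  assumes v: "v absolutely_integrable_on {s..d}" and p: "s \<le> p" "p \<le> d"
  shows "(\<lambda>n. integral {s..d} (\<lambda>t. spline_step (real n * (t - p)) *\<^sub>R v t)) \<longlonglongrightarrow> integral {p..d} v"
proof -
  \<comment> \<open>The limit is 0 at \<open>p\<close> itself, where every step starts from 0; this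
    single point is removed later by a spike argument.\<close>
  define l where "l t = (if t \<le> p then 0 else v t)" for t
  have nv: "(\<lambda>t. norm (v t)) integrable_on {s..d}"
    using v absolutely_integrable_on_def by blast
  have int: "(\<lambda>t. spline_step (real k * (t - p)) *\<^sub>R v t) integrable_on {s..d}" for k
  proof -
    have "continuous_on {s..d} (\<lambda>t. spline_step (real k * (t - p)))"
      by (rule continuous_on_compose2[OF spline_step_cont[of UNIV]]) (auto intro!: continuous_intros)
    then show ?thesis
      using absolutely_integrable_continuous_scaleR[OF _ v] set_lebesgue_integral_eq_integral(1) by blast
  qed
  have lim: "(\<lambda>n. spline_step (real n * (t - p)) *\<^sub>R v t) \<longlonglongrightarrow> l t" for t
  proof (cases "t \<le> p")
    case True
    then show ?thesis by (simp add: l_def spline_step_zero mult_nonneg_nonpos)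
  next
    case False
    obtain m where m: "1 / (t - p) \<le> real m" using real_arch_simple by blast
    have "spline_step (real n * (t - p)) *\<^sub>R v t = l t" if "m \<le> n" for n
    proof -
      have "1 / (t - p) \<le> real n" using m that by linarith
      then have "1 \<le> real n * (t - p)" using False by (simp add: field_simps)
      then show ?thesis using False by (simp add: l_def spline_step_one)
    qed
    then show ?thesis
      by (intro tendsto_eventually) (auto simp: eventually_sequentially)
  qed
  note dc = dominated_convergence[where f="\<lambda>k t. spline_step (real k * (t - p)) *\<^sub>R v t", OF int nv _ lim]
  have bd: "norm (spline_step (real k * (t - p)) *\<^sub>R v t) \<le> norm (v t)" for k t
    using spline_step_bounds by (simp add: mult_left_le_one_le)
  have "integral {s..d} l = integral {s..p} l + integral {p..d} l"
    using p dc(1)[OF bd] by (simp add: Henstock_Kurzweil_Integration.integral_combine)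
  also have "integral {s..p} l = 0"
    using integral_cong[of "{s..p}" l "\<lambda>_. 0"] by (simp add: l_def)
  also have "integral {p..d} l = integral {p..d} v"
    by (rule integral_spike[of "{p}"]) (auto simp: l_def)
  finally show ?thesis using dc(2)[OF bd] by simp
qed

text \<open>The rescaled tents are a one-sided approximate identity: nonnegative, of mass 1 and
  supported in [p, p + 1/n]. Hence p = s is admissible, whereas room is required to the right of
  \<open>p\<close>.\<close>

lemma spline_tent_tendsto_value:
  fixes u :: "real \<Rightarrow> 'a::euclidean_space"
  assumes u: "continuous_on {s..d} u" and p: "s \<le> p" "p < d"
  shows "(\<lambda>n. integral {s..d} (\<lambda>t. (real n * spline_tent (real n * (t - p))) *\<^sub>R u t)) \<longlonglongrightarrow> u p"
proof (rule LIMSEQ_I)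
  fix \<epsilon> :: real assume "0 < \<epsilon>"
  then obtain \<delta> where \<delta>: "0 < \<delta>" "\<And>t. t \<in> {s..d} \<Longrightarrow> dist t p < \<delta> \<Longrightarrow> dist (u t) (u p) < \<epsilon>/2"
    using u p unfolding continuous_on_iff by (metis atLeastAtMost_iff half_gt_zero less_imp_le)
  \<comment> \<open>From \<open>m\<close> on, the support [p, p + 1/n] lies within \<delta> of
    \<open>p\<close> and inside {s..d}.\<close>
  obtain m where m: "1 / min \<delta> (d - p) < real m" using reals_Archimedean2 by blast
  have "norm (integral {s..d} (\<lambda>t. (real n * spline_tent (real n * (t - p))) *\<^sub>R u t) - u p) < \<epsilon>" if "m \<le> n" for n
  proof -
    have n: "1 / min \<delta> (d - p) < real n" using m that by linarith
    have n0: "0 < real n" using n \<delta>(1) p(2) by (smt (verit) divide_pos_pos min_def)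
    have n1: "1 < real n * \<delta>" "1 < real n * (d - p)"
    proof -
      have "1 < real n * min \<delta> (d - p)"
        using n \<delta>(1) p(2) by (simp add: divide_less_eq)
      moreover have "real n * min \<delta> (d - p) \<le> real n * \<delta>" "real n * min \<delta> (d - p) \<le> real n * (d - p)"
        using n0 by (auto intro!: mult_left_mono)
      ultimately show "1 < real n * \<delta>" "1 < real n * (d - p)" by linarith+
    qed
    define \<rho> where "\<rho> t = real n * spline_tent (real n * (t - p))" for t
    have \<rho>0: "0 \<le> \<rho> t" for t using spline_tent_nonneg by (simp add: \<rho>_def)
    have c\<rho>: "continuous_on {s..d} \<rho>"
      unfolding \<rho>_def
      by (intro continuous_intros continuous_on_compose2[OF spline_tent_cont[of UNIV]]) auto
    \<comment> \<open>The mass of \<rho> is the increment of its primitive, the rescaled step, which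
      is 0 at \<open>s\<close> and 1 at \<open>d\<close>.\<close>
    have "(\<rho> has_integral (spline_step (real n * (d - p)) - spline_step (real n * (s - p)))) {s..d}"
      unfolding \<rho>_def
      by (rule fundamental_theorem_of_calculus)
        (use p in \<open>auto intro!: has_vector_derivative_at_within[OF spline_step_scaled_deriv[unfolded has_real_derivative_iff_has_vector_derivative]]\<close>)
    then have i\<rho>: "(\<rho> has_integral 1) {s..d}"
      using n1 p by (simp add: spline_step_one spline_step_zero mult_nonneg_nonpos)
    have iu: "(\<lambda>t. \<rho> t *\<^sub>R u t) integrable_on {s..d}"
      by (intro integrable_continuous_interval continuous_intros c\<rho> u)
    have "((\<lambda>t. \<rho> t *\<^sub>R u p) has_integral 1 *\<^sub>R u p) {s..d}"
      by (rule has_integral_scaleR_left[OF i\<rho>])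
    then have "((\<lambda>t. \<rho> t *\<^sub>R u t - \<rho> t *\<^sub>R u p) has_integral (integral {s..d} (\<lambda>t. \<rho> t *\<^sub>R u t) - u p)) {s..d}"
      using has_integral_diff[OF integrable_integral[OF iu]] by force
    then have eq: "integral {s..d} (\<lambda>t. \<rho> t *\<^sub>R u t) - u p = integral {s..d} (\<lambda>t. \<rho> t *\<^sub>R u t - \<rho> t *\<^sub>R u p)"
      and int: "(\<lambda>t. \<rho> t *\<^sub>R u t - \<rho> t *\<^sub>R u p) integrable_on {s..d}"
      by (auto simp: integral_unique)
    have "norm (integral {s..d} (\<lambda>t. \<rho> t *\<^sub>R u t - \<rho> t *\<^sub>R u p)) \<le> integral {s..d} (\<lambda>t. \<rho> t * (\<epsilon>/2))"
    proof (rule integral_norm_bound_integral[OF int])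
      show "(\<lambda>t. \<rho> t * (\<epsilon>/2)) integrable_on {s..d}"
        by (intro integrable_continuous_interval continuous_intros c\<rho>)
      fix t assume t: "t \<in> {s..d}"
      show "norm (\<rho> t *\<^sub>R u t - \<rho> t *\<^sub>R u p) \<le> \<rho> t * (\<epsilon>/2)"
      proof (cases "dist t p < \<delta>")
        case True
        then have "norm (u t - u p) \<le> \<epsilon>/2" using \<delta>(2)[OF t] by (simp add: dist_norm)
        then show ?thesis
          using \<rho>0[of t] by (simp add: scaleR_diff_right[symmetric] mult_left_mono del: times_divide_eq_right)
      next
        case False
        then have "real n * (t - p) \<le> 0 \<or> 1 \<le> real n * (t - p)"
        proof (cases "t \<le> p")
          case F: False
          then have "real n * \<delta> \<le> real n * (t - p)"
            using False by (intro mult_left_mono) (auto simp: dist_real_def)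
          then show ?thesis using n1 by simp
        qed (simp add: mult_nonneg_nonpos)
        then have "\<rho> t = 0" by (auto simp: \<rho>_def spline_tent_zero)
        then show ?thesis by simp
      qed
    qed
    also have "\<dots> = \<epsilon>/2"
      using i\<rho> by (simp add: integral_unique)
    finally show ?thesis using eq \<open>0 < \<epsilon>\<close> unfolding \<rho>_def by simp
  qed
  then show "\<exists>no. \<forall>n\<ge>no. norm (integral {s..d} (\<lambda>t. (real n * spline_tent (real n * (t - p))) *\<^sub>R u t) - u p) < \<epsilon>"
    by blast
qed

text \<open>The test function is a difference of two rescaled steps, rising just after
  \<open>s\<close> and falling just after \<open>t\<close>. As n grows, its derivative picks out u s
  - u t, while the function itself tends to the indicator of the interval from \<open>s\<close> to
  \<open>t\<close>.\<close>

lemma weak_derivative_imp_integral: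
  fixes u v :: "real \<Rightarrow> 'a::euclidean_space"
  assumes J: "open J" and u: "continuous_on J u" and v: "locally_integrable_on v J"
    and weak: "has_weak_derivative_on u v J" and st: "s \<le> t" "{s..t} \<subseteq> J"
  shows "u t - u s = integral {s..t} v"
proof -
  have "t \<in> J" using st by auto
  then obtain \<eta> where \<eta>: "0 < \<eta>" "cball t \<eta> \<subseteq> J" using J open_contains_cball by blast
  \<comment> \<open>The second step falls on [t, t + 1/n], so the support reaches beyond
    \<open>t\<close>; openness of \<open>J\<close> leaves room up to \<open>d\<close>.\<close>
  define d where "d = t + \<eta>"
  have sd: "{s..d} \<subseteq> J"
  proof
    fix r assume "r \<in> {s..d}"
    then have "r \<in> {s..t} \<or> r \<in> cball t \<eta>" by (auto simp: d_def dist_real_def)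
    then show "r \<in> J" using st(2) \<eta>(2) by blast
  qed
  have td: "t < d" using \<eta>(1) by (simp add: d_def)
  have va: "v absolutely_integrable_on {s..d}"
    using v sd unfolding locally_integrable_on_def by blast
  have uc: "continuous_on {s..d} u" using u sd continuous_on_subset by blast
  let ?S = "\<lambda>n p r. spline_step (real n * (r - p))"
  let ?T = "\<lambda>n p r. real n * spline_tent (real n * (r - p))"
  have cS: "continuous_on X (?S n p)" for n p and X :: "real set"
    by (rule continuous_on_compose2[OF spline_step_cont[of UNIV]]) (auto intro!: continuous_intros)
  have cT: "continuous_on X (?T n p)" for n p and X :: "real set"
    by (intro continuous_intros continuous_on_compose2[OF spline_tent_cont[of UNIV]]) auto
  obtain m where m: "1 / \<eta> < real m" using reals_Archimedean2 by blast
  have eq: "integral {s..d} (\<lambda>r. ?T n s r *\<^sub>R u r) - integral {s..d} (\<lambda>r. ?T n t r *\<^sub>R u r) =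
      integral {s..d} (\<lambda>r. ?S n t r *\<^sub>R v r) - integral {s..d} (\<lambda>r. ?S n s r *\<^sub>R v r)" if "m \<le> n" for n
  proof -
    define \<phi> where "\<phi> r = ?S n s r - ?S n t r" for r
    have "1 / \<eta> < real n" using m that by linarith
    then have n\<eta>: "1 \<le> real n * \<eta>" using \<eta>(1) by (simp add: field_simps)
    have D: "(\<phi> has_real_derivative (?T n s r - ?T n t r)) (at r)" for r
      unfolding \<phi>_def by (intro DERIV_diff spline_step_scaled_deriv)
    then have dd: "deriv \<phi> r = ?T n s r - ?T n t r" for r by (rule DERIV_imp_deriv)
    \<comment> \<open>To the left of \<open>s\<close> both steps are 0 and to the right of
      \<open>d\<close> both are 1, so their difference vanishes in either case.\<close>
    have out: "real n * (r - s) \<le> 0 \<and> real n * (r - t) \<le> 0 \<or>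
        1 \<le> real n * (r - s) \<and> 1 \<le> real n * (r - t)" if "r \<notin> {s..d}" for r
    proof (cases "r < s")
      case True
      then show ?thesis using st by (simp add: mult_nonneg_nonpos)
    next
      case False
      then have "\<eta> \<le> r - t" "\<eta> \<le> r - s" using that st by (auto simp: d_def)
      then have "real n * \<eta> \<le> real n * (r - t)" "real n * \<eta> \<le> real n * (r - s)"
        by (auto intro!: mult_left_mono)
      then show ?thesis using n\<eta> by linarith
    qed
    have out0: "\<phi> r = 0" "deriv \<phi> r = 0" if "r \<notin> {s..d}" for r
      using out[OF that] unfolding \<phi>_def dd by (auto simp: spline_step_zero spline_step_one spline_tent_zero)
    have "test_function J \<phi>"
      unfolding test_function_def C1_differentiable_on_def
    proof (intro conjI exI)
      show "\<forall>x\<in>UNIV. (\<phi> has_vector_derivative (?T n s x - ?T n t x)) (at x)"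
        using D by (simp add: has_real_derivative_iff_has_vector_derivative)
      show "continuous_on UNIV (\<lambda>x. ?T n s x - ?T n t x)" by (intro continuous_on_diff cT)
      show "compact {s..d}" by simp
    qed (use sd out0 in auto)
    then have w: "set_lebesgue_integral lebesgue J (\<lambda>r. deriv \<phi> r *\<^sub>R u r) =
       - set_lebesgue_integral lebesgue J (\<lambda>r. \<phi> r *\<^sub>R v r)"
      using weak unfolding has_weak_derivative_on_def by blast
    have "set_lebesgue_integral lebesgue J (\<lambda>r. deriv \<phi> r *\<^sub>R u r) = integral {s..d} (\<lambda>r. deriv \<phi> r *\<^sub>R u r)"
    proof (rule set_lebesgue_integral_eq_integral_interval[OF _ sd])
      show "(\<lambda>r. deriv \<phi> r *\<^sub>R u r) absolutely_integrable_on {s..d}"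
        unfolding dd by (intro absolutely_integrable_continuous_real continuous_intros continuous_on_diff cT uc)
    qed (use out0 in auto)
    also have "\<dots> = integral {s..d} (\<lambda>r. ?T n s r *\<^sub>R u r) - integral {s..d} (\<lambda>r. ?T n t r *\<^sub>R u r)"
      unfolding dd scaleR_diff_left
      by (intro integral_diff integrable_continuous_interval continuous_on_scaleR cT uc)
    finally have 1: "set_lebesgue_integral lebesgue J (\<lambda>r. deriv \<phi> r *\<^sub>R u r) = \<dots>" .
    have Sv: "(\<lambda>r. ?S n p r *\<^sub>R v r) integrable_on {s..d}" for p
      using absolutely_integrable_continuous_scaleR[OF cS va] set_lebesgue_integral_eq_integral(1) by blast
    have "set_lebesgue_integral lebesgue J (\<lambda>r. \<phi> r *\<^sub>R v r) = integral {s..d} (\<lambda>r. \<phi> r *\<^sub>R v r)"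
    proof (rule set_lebesgue_integral_eq_integral_interval[OF _ sd])
      show "(\<lambda>r. \<phi> r *\<^sub>R v r) absolutely_integrable_on {s..d}"
        unfolding \<phi>_def by (intro absolutely_integrable_continuous_scaleR va continuous_on_diff cS)
    qed (use out0 in auto)
    also have "\<dots> = integral {s..d} (\<lambda>r. ?S n s r *\<^sub>R v r) - integral {s..d} (\<lambda>r. ?S n t r *\<^sub>R v r)"
      unfolding \<phi>_def scaleR_diff_left by (intro integral_diff Sv)
    finally show ?thesis using w 1 by simp
  qed
  have "(\<lambda>n. integral {s..d} (\<lambda>r. ?T n s r *\<^sub>R u r) - integral {s..d} (\<lambda>r. ?T n t r *\<^sub>R u r)) \<longlonglongrightarrow> u s - u t"
    by (intro tendsto_diff spline_tent_tendsto_value uc) (use st td in auto)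
  moreover have "(\<lambda>n. integral {s..d} (\<lambda>r. ?S n t r *\<^sub>R v r) - integral {s..d} (\<lambda>r. ?S n s r *\<^sub>R v r))
      \<longlonglongrightarrow> integral {t..d} v - integral {s..d} v"
    by (intro tendsto_diff spline_step_tendsto_integral va) (use st td in auto)
  then have "(\<lambda>n. integral {s..d} (\<lambda>r. ?T n s r *\<^sub>R u r) - integral {s..d} (\<lambda>r. ?T n t r *\<^sub>R u r))
      \<longlonglongrightarrow> integral {t..d} v - integral {s..d} v"
    by (rule Lim_transform_eventually) (use eq[symmetric] in \<open>auto simp: eventually_sequentially\<close>)
  ultimately have "u s - u t = integral {t..d} v - integral {s..d} v"
    by (rule LIMSEQ_unique)
  moreover have "integral {s..t} v + integral {t..d} v = integral {s..d} v"
    using st td va by (intro Henstock_Kurzweil_Integration.integral_combine set_lebesgue_integral_eq_integral(1)) auto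
  ultimately have "(u s + integral {s..t} v) + integral {t..d} v = u t + integral {t..d} v"
    by (simp add: algebra_simps)
  then have "u s + integral {s..t} v = u t" by simp
  then show ?thesis by (metis add_diff_cancel_left')
qed

section \<open>Continuously differentiable curves are Sobolev curves\<close>

lemma compact_subset_open_interval:
  fixes K :: "real set"
  assumes "compact K" "K \<subseteq> J" "open J" "is_interval J" "J \<noteq> {}"
  obtains c d where "c < d" "{c..d} \<subseteq> J" "K \<subseteq> {c<..<d}"
proof -
  obtain p where p: "p \<in> J" using assms(5) by blast
  \<comment> \<open>The added point guarantees a minimum and a maximum even when \<open>K\<close> is
    empty.\<close>
  define K' where "K' = insert p K"
  have K': "compact K'" "K' \<noteq> {}" "K' \<subseteq> J" using assms p by (auto simp: K'_def)
  obtain l where l: "l \<in> K'" "\<And>x. x \<in> K' \<Longrightarrow> l \<le> x" using compact_attains_inf[OF K'(1,2)] by blast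
  obtain r where r: "r \<in> K'" "\<And>x. x \<in> K' \<Longrightarrow> x \<le> r" using compact_attains_sup[OF K'(1,2)] by blast
  obtain e1 where e1: "0 < e1" "cball l e1 \<subseteq> J" using assms(3) l K' open_contains_cball by blast
  obtain e2 where e2: "0 < e2" "cball r e2 \<subseteq> J" using assms(3) r K' open_contains_cball by blast
  have "l - e1 \<in> J" "r + e2 \<in> J" using e1 e2 by (auto simp: subset_iff dist_real_def)
  then have "{l - e1..r + e2} \<subseteq> J"
    using assms(4) by (meson atLeastAtMost_iff is_interval_1 subsetI)
  moreover have "l \<le> r" using l(2)[OF r(1)] .
  moreover have "K \<subseteq> {l - e1<..<r + e2}" using l(2) r(2) e1(1) e2(1) by (force simp: K'_def)
  ultimately show thesis using that[of "l - e1" "r + e2"] e1(1) e2(1) by simp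
qed

text \<open>The classical derivative is a weak one by integration by parts: the support of a test
  function lies strictly inside some [c, d], so the boundary terms vanish.\<close>

lemma C1_imp_W11_loc:
  fixes y y' :: "real \<Rightarrow> 'a::euclidean_space"
  assumes J: "open J" "is_interval J" "J \<noteq> {}"
    and D: "\<And>t. t \<in> J \<Longrightarrow> (y has_vector_derivative y' t) (at t)" and c': "continuous_on J y'"
  shows "y \<in> W11_loc J"
proof -
  have cy: "continuous_on J y"
    using D by (meson continuous_at_imp_continuous_on has_vector_derivative_continuous)
  have li: "locally_integrable_on g J" if g: "continuous_on J g" for g :: "real \<Rightarrow> 'a"
    unfolding locally_integrable_on_def
  proof safe
    fix K assume K: "compact K" "K \<subseteq> J"
    obtain c d where cd: "c < d" "{c..d} \<subseteq> J" "K \<subseteq> {c<..<d}"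
      by (rule compact_subset_open_interval[OF K J])
    have "g absolutely_integrable_on {c..d}"
      using g cd(2) continuous_on_subset by (intro absolutely_integrable_continuous_real) blast
    then show "g absolutely_integrable_on K"
      by (rule set_integrable_subset) (use K cd(3) lmeasurable_compact in \<open>auto simp: less_imp_le subset_iff\<close>)
  qed
  have "has_weak_derivative_on y y' J"
    unfolding has_weak_derivative_on_def
  proof safe
    fix \<phi> assume "test_function J \<phi>"
    then obtain \<phi>' K where \<phi>': "\<And>t. (\<phi> has_real_derivative \<phi>' t) (at t)" "continuous_on UNIV \<phi>'"
      and K: "compact K" "K \<subseteq> J" "\<And>t. t \<notin> K \<Longrightarrow> \<phi> t = 0"
      unfolding test_function_def C1_differentiable_on_def
      by (auto simp: has_real_derivative_iff_has_vector_derivative)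
    obtain c d where cd: "c < d" "{c..d} \<subseteq> J" "K \<subseteq> {c<..<d}"
      by (rule compact_subset_open_interval[OF K(1,2) J])
    have dd: "deriv \<phi> = \<phi>'" using \<phi>'(1) DERIV_imp_deriv by blast
    have c\<phi>: "continuous_on {c..d} \<phi>"
      using \<phi>'(1) by (meson DERIV_continuous_on has_field_derivative_at_within)
    have c\<phi>': "continuous_on {c..d} \<phi>'" using \<phi>'(2) continuous_on_subset by blast
    have cy1: "continuous_on {c..d} y" "continuous_on {c..d} y'"
      using cy c' cd(2) continuous_on_subset by blast+
    \<comment> \<open>The complement of \<open>K\<close> is open, so \<phi> vanishes in a whole
      neighbourhood of \<open>t\<close>.\<close>
    have z': "\<phi>' t = 0" if "t \<notin> K" for t
    proof -
      have "(\<phi> has_real_derivative 0) (at t)"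
        by (rule has_field_derivative_transform_within_open[where f="\<lambda>_. 0" and S="- K"])
          (use K that in \<open>auto simp: compact_imp_closed\<close>)
      then show ?thesis using \<phi>'(1) DERIV_unique by blast
    qed
    have out: "t \<notin> K" if "t \<notin> {c..d}" for t using that cd(3) by auto
    have 1: "set_lebesgue_integral lebesgue J (\<lambda>t. \<phi>' t *\<^sub>R y t) = integral {c..d} (\<lambda>t. \<phi>' t *\<^sub>R y t)"
    proof (rule set_lebesgue_integral_eq_integral_interval[OF _ cd(2)])
      show "(\<lambda>t. \<phi>' t *\<^sub>R y t) absolutely_integrable_on {c..d}"
        by (intro absolutely_integrable_continuous_real continuous_on_scaleR c\<phi>' cy1)
      show "\<phi>' t *\<^sub>R y t = 0" if "t \<in> J - {c..d}" for t
        using z'[of t] out[of t] that by simp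
    qed
    have 2: "set_lebesgue_integral lebesgue J (\<lambda>t. \<phi> t *\<^sub>R y' t) = integral {c..d} (\<lambda>t. \<phi> t *\<^sub>R y' t)"
    proof (rule set_lebesgue_integral_eq_integral_interval[OF _ cd(2)])
      show "(\<lambda>t. \<phi> t *\<^sub>R y' t) absolutely_integrable_on {c..d}"
        by (intro absolutely_integrable_continuous_real continuous_on_scaleR c\<phi> cy1)
      show "\<phi> t *\<^sub>R y' t = 0" if "t \<in> J - {c..d}" for t
        using K(3)[of t] out[of t] that by simp
    qed
    have "((\<lambda>t. \<phi> t *\<^sub>R y' t + \<phi>' t *\<^sub>R y t) has_integral \<phi> d *\<^sub>R y d - \<phi> c *\<^sub>R y c) {c..d}"
    proof (rule fundamental_theorem_of_calculus)
      fix t assume "t \<in> {c..d}"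
      then have "(y has_vector_derivative y' t) (at t)" using D cd(2) by blast
      then show "((\<lambda>t. \<phi> t *\<^sub>R y t) has_vector_derivative \<phi> t *\<^sub>R y' t + \<phi>' t *\<^sub>R y t) (at t within {c..d})"
        by (rule has_vector_derivative_at_within[OF has_vector_derivative_scaleR[OF \<phi>'(1)]])
    qed (use cd in simp)
    moreover have "\<phi> d = 0 \<and> \<phi> c = 0" using K(3)[of d] K(3)[of c] cd(3) by (auto simp: subset_iff)
    ultimately have "integral {c..d} (\<lambda>t. \<phi> t *\<^sub>R y' t + \<phi>' t *\<^sub>R y t) = 0"
      by (simp add: integral_unique)
    moreover have "integral {c..d} (\<lambda>t. \<phi> t *\<^sub>R y' t + \<phi>' t *\<^sub>R y t) =
        integral {c..d} (\<lambda>t. \<phi> t *\<^sub>R y' t) + integral {c..d} (\<lambda>t. \<phi>' t *\<^sub>R y t)"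
      by (intro integral_add integrable_continuous_interval continuous_on_scaleR c\<phi> c\<phi>' cy1)
    ultimately show "set_lebesgue_integral lebesgue J (\<lambda>t. deriv \<phi> t *\<^sub>R y t) =
        - set_lebesgue_integral lebesgue J (\<lambda>t. \<phi> t *\<^sub>R y' t)"
      unfolding dd 1 2 by (simp add: eq_neg_iff_add_eq_0 add.commute)
  qed
  then show ?thesis
    unfolding W11_loc_def using cy li[OF cy] li[OF c'] by blast
qed

section \<open>The vector field\<close>

text \<open>The norm of the matrix type is the Frobenius norm, so the bound is Cauchy-Schwarz
  applied row by row.\<close>

lemma norm_matrix_vector_mult_le:
  fixes M :: "real^'n^'m"
  shows "norm (M *v u) \<le> norm M * norm u"
proof -
  have "norm (M *v u) = L2_set (\<lambda>i. norm (M $ i \<bullet> u)) UNIV"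
    unfolding norm_vec_def by (simp add: matrix_vector_mul_component)
  also have "\<dots> \<le> L2_set (\<lambda>i. norm (M $ i) * norm u) UNIV"
    by (rule L2_set_mono) (auto simp: Cauchy_Schwarz_ineq2)
  also have "\<dots> = norm M * norm u"
    unfolding norm_vec_def[of M] by (rule L2_set_left_distrib[symmetric]) simp
  finally show ?thesis .
qed

text \<open>For the converse, let \<open>z\<close> be the component of \<open>g\<close> orthogonal
  to the range. Then |A z|^2 is the inner product of \<open>z\<close> with A^T A z, which is 0; so
  \<open>z\<close> is in the kernel, \<open>g\<close> is orthogonal to \<open>z\<close>, and z =
  0.\<close>

lemma in_range_transpose_iff:
  fixes A :: "real^'n^'m"
  shows "g \<in> range ((*v) (transpose A)) \<longleftrightarrow> (\<forall>w. A *v w = 0 \<longrightarrow> g \<bullet> w = 0)"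
proof
  assume "g \<in> range ((*v) (transpose A))"
  then obtain q where "g = transpose A *v q" by blast
  then show "\<forall>w. A *v w = 0 \<longrightarrow> g \<bullet> w = 0"
    by (metis dot_lmul_matrix inner_zero_right transpose_matrix_vector)
next
  assume *: "\<forall>w. A *v w = 0 \<longrightarrow> g \<bullet> w = 0"
  let ?U = "range ((*v) (transpose A))"
  have "subspace ?U"
    by (intro linear_subspace_image) auto
  then have U: "span ?U = ?U" by (rule span_eq_iff[THEN iffD2])
  obtain y z where yz: "y \<in> span ?U" "\<And>w. w \<in> span ?U \<Longrightarrow> orthogonal z w" "g = y + z"
    using orthogonal_subspace_decomp_exists[of ?U g] by blast
  have "z \<bullet> (transpose A *v (A *v z)) = 0"
    using yz(2) U unfolding orthogonal_def by blast
  moreover have "z \<bullet> (transpose A *v (A *v z)) = (A *v z) \<bullet> (A *v z)"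
    by (metis dot_lmul_matrix inner_commute transpose_matrix_vector)
  ultimately have "A *v z = 0" by simp
  then have "g \<bullet> z = 0" using * by blast
  moreover have "z \<bullet> y = 0" using yz(1,2) unfolding orthogonal_def by blast
  ultimately have "z \<bullet> z = 0" using yz(3) by (simp add: inner_add_left inner_commute[of y z])
  then show "g \<in> ?U" using yz(1,3) unfolding U by simp
qed

text \<open>Translates between the inclusion and the differential equation at one instant. The sum
  \<open>w\<close> of \<open>p\<close> and the Riemannian gradient lies in ker A; testing both
  variational identities with \<open>w\<close> leaves (H x *v w) \<bullet> w = 0, so w = 0.\<close>

lemma HR_grad_unique:
  fixes A :: "real^'n^'m"
  assumes A: "rank A = CARD('m)" and H: "sym_pos_def (H x)"
  shows "A *v p = 0 \<and> H x *v p + grad f x \<in> range ((*v) (transpose A)) \<longleftrightarrow> p = - HR_grad A H f x"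
proof
  let ?V = "HR_grad A H f x"
  note V = HR_grad_riemannian(1)[where A=A and H=H and x=x and f=f, OF A H]
    HR_grad_riemannian(2)[where A=A and H=H and x=x and f=f, OF A H]
  {
    assume p: "A *v p = 0 \<and> H x *v p + grad f x \<in> range ((*v) (transpose A))"
    define w where "w = p + ?V"
    have Aw: "A *v w = 0" using p V(1) by (simp add: w_def matrix_vector_right_distrib)
    have "(H x *v p + grad f x) \<bullet> w = 0" using p Aw in_range_transpose_iff by blast
    moreover have "(H x *v ?V) \<bullet> w = grad f x \<bullet> w" using V(2) Aw by blast
    ultimately have "(H x *v w) \<bullet> w = 0"
      by (simp add: w_def matrix_vector_right_distrib inner_add_left)
    then have "w = 0" using H unfolding sym_pos_def_def by (metis less_irrefl)
    then show "p = - ?V" by (simp add: w_def eq_neg_iff_add_eq_0)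
  }
  assume p: "p = - ?V"
  have "A *v p = - (A *v ?V)" "H x *v p = - (H x *v ?V)"
    using matrix_vector_mult_diff_distrib[of A 0 ?V] matrix_vector_mult_diff_distrib[of "H x" 0 ?V] p
    by simp_all
  then show "A *v p = 0 \<and> H x *v p + grad f x \<in> range ((*v) (transpose A))"
    unfolding in_range_transpose_iff using V by (simp add: inner_diff_left)
qed

text \<open>The constant is the minimum of the quadratic form on the compact unit sphere;
  homogeneity extends the bound to all vectors.\<close>

lemma sym_pos_def_coercive:
  fixes M :: "real^'n^'n"
  assumes "sym_pos_def M"
  obtains c where "0 < c" "\<And>u. c * (norm u)\<^sup>2 \<le> (M *v u) \<bullet> u"
proof -
  have "sphere (0::real^'n) 1 \<noteq> {}" by simp
  moreover have "continuous_on (sphere 0 1) (\<lambda>u. (M *v u) \<bullet> u)"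
    by (intro continuous_intros linear_continuous_on matrix_vector_mul_bounded_linear)
  ultimately obtain u0 where u0: "u0 \<in> sphere 0 1"
      "\<And>u. u \<in> sphere 0 1 \<Longrightarrow> (M *v u0) \<bullet> u0 \<le> (M *v u) \<bullet> u"
    using continuous_attains_inf[of "sphere (0::real^'n) 1" "\<lambda>u. (M *v u) \<bullet> u"] by auto
  show thesis
  proof
    show "0 < (M *v u0) \<bullet> u0" using assms u0(1) unfolding sym_pos_def_def by (metis mem_sphere_0 norm_zero zero_neq_one)
    fix u :: "real^'n"
    show "(M *v u0) \<bullet> u0 * (norm u)\<^sup>2 \<le> (M *v u) \<bullet> u"
    proof (cases "u = 0")
      case False
      define e where "e = (1 / norm u) *\<^sub>R u"
      have "(M *v u0) \<bullet> u0 \<le> (M *v e) \<bullet> e" using u0(2)[of e] False by (simp add: e_def)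
      then have "(M *v u0) \<bullet> u0 * (norm u)\<^sup>2 \<le> ((M *v e) \<bullet> e) * (norm u)\<^sup>2"
        by (rule mult_right_mono) simp
      also have "\<dots> = (M *v (norm u *\<^sub>R e)) \<bullet> (norm u *\<^sub>R e)"
        by (simp add: matrix_vector_mult_scaleR power2_eq_square)
      also have "norm u *\<^sub>R e = u" using False by (simp add: e_def)
      finally show ?thesis .
    qed simp
  qed
qed

text \<open>Testing the variational characterisation of the gradients at \<open>x\<close> and \<open>y\<close> with their difference
  and using coercivity avoids differentiating matrix inverses.\<close>

lemma HR_grad_lipschitz:
  fixes A :: "real^'n^'m"
  assumes A: "rank A = CARD('m)" and C: "open C" and pd: "\<And>x. x \<in> C \<Longrightarrow> sym_pos_def (H x)"
    and LH: "locally_lipschitz_on C H" and Lf: "locally_lipschitz_on UNIV (grad f)"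
    and p: "p \<in> C"
  obtains r L where "0 < r" "ball p r \<subseteq> C" "L-lipschitz_on (ball p r) (HR_grad A H f)"
proof -
  obtain r1 L1 where r1: "0 < r1" and L1': "\<And>s. s \<in> cball (0::real) r1 \<inter> UNIV \<Longrightarrow> L1-lipschitz_on (cball p r1 \<inter> C) H"
    using local_lipschitzE[OF LH[unfolded locally_lipschitz_on_def], of 0 p] p by (metis UNIV_I)
  have L1: "L1-lipschitz_on (cball p r1 \<inter> C) H" using L1'[of 0] r1 by simp
  obtain r2 L2 where r2: "0 < r2" and L2': "\<And>s. s \<in> cball (0::real) r2 \<inter> UNIV \<Longrightarrow> L2-lipschitz_on (cball p r2 \<inter> UNIV) (grad f)"
    using local_lipschitzE[OF Lf[unfolded locally_lipschitz_on_def], of 0 p] by (metis UNIV_I)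
  have L2: "L2-lipschitz_on (cball p r2) (grad f)" using L2'[of 0] r2 by simp
  obtain r3 where r3: "0 < r3" "ball p r3 \<subseteq> C" using C p open_contains_ball by blast
  obtain c where c: "0 < c" "\<And>u. c * (norm u)\<^sup>2 \<le> (H p *v u) \<bullet> u"
    using sym_pos_def_coercive[OF pd[OF p]] by blast
  have L12: "0 \<le> L1" "0 \<le> L2" using L1 L2 lipschitz_on_nonneg by blast+
  \<comment> \<open>The last entry keeps \<open>H\<close> within c/2 of \<open>H p\<close> on the
    ball, so that coercivity survives there with constant c/2.\<close>
  define r where "r = Min {r1, r2, r3, c / (2 * (L1 + 1))}"
  have r: "0 < r" "r \<le> r1" "r \<le> r2" "r \<le> r3" "r \<le> c / (2 * (L1 + 1))"
    using r1 r2 r3 c L12 by (auto simp: r_def)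
  have sub: "ball p r \<subseteq> C" "ball p r \<subseteq> cball p r1" "ball p r \<subseteq> cball p r2"
    using r r3(2) by auto
  have LH': "norm (H x - H y) \<le> L1 * norm (x - y)" if "x \<in> ball p r" "y \<in> ball p r" for x y
    using lipschitz_onD[OF L1, of x y] that sub unfolding dist_norm by blast
  have Lg': "norm (grad f x - grad f y) \<le> L2 * norm (x - y)" if "x \<in> ball p r" "y \<in> ball p r" for x y
    using lipschitz_onD[OF L2, of x y] that sub unfolding dist_norm by blast
  have coer: "c/2 * (norm u)\<^sup>2 \<le> (H x *v u) \<bullet> u" if x: "x \<in> ball p r" for x u
  proof -
    have "norm (H x - H p) \<le> L1 * norm (x - p)" using LH'[OF x, of p] r(1) by simp
    also have "\<dots> \<le> L1 * (c / (2 * (L1 + 1)))"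
      using x r(5) L12 by (intro mult_left_mono) (auto simp: dist_norm norm_minus_commute)
    also have "\<dots> \<le> c/2" using L12 c(1) by (simp add: field_simps)
    finally have n: "norm (H x - H p) \<le> c/2" .
    have "\<bar>((H x - H p) *v u) \<bullet> u\<bar> \<le> norm ((H x - H p) *v u) * norm u" by (rule Cauchy_Schwarz_ineq2)
    also have "\<dots> \<le> (norm (H x - H p) * norm u) * norm u"
      by (intro mult_right_mono norm_matrix_vector_mult_le) simp
    also have "\<dots> \<le> (c/2 * norm u) * norm u" using n by (intro mult_right_mono) auto
    finally have "\<bar>((H x - H p) *v u) \<bullet> u\<bar> \<le> c/2 * (norm u)\<^sup>2" by (simp add: power2_eq_square)
    moreover have "(H x *v u) \<bullet> u = (H p *v u) \<bullet> u + ((H x - H p) *v u) \<bullet> u"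
      by (simp add: matrix_vector_mult_diff_rdistrib inner_diff_left)
    ultimately show ?thesis using c(2)[of u] by linarith
  qed
  let ?V = "HR_grad A H f"
  note V1 = HR_grad_riemannian(1)[where A=A and H=H and f=f, OF A pd]
    and V2 = HR_grad_riemannian(2)[where A=A and H=H and f=f, OF A pd]
  \<comment> \<open>A bound for the Riemannian gradient on the ball: testing it with itself gives
    c/2 * norm (?V x) \<le> norm (grad f x).\<close>
  define M where "M = 2 / c * (norm (grad f p) + L2 * r)"
  have M0: "0 \<le> M" using c(1) L12 r(1) by (simp add: M_def)
  have VM: "norm (?V x) \<le> M" if x: "x \<in> ball p r" for x
  proof -
    have xC: "x \<in> C" using x sub by blast
    have "c/2 * norm (?V x) * norm (?V x) \<le> (H x *v ?V x) \<bullet> ?V x"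
      using coer[OF x, of "?V x"] by (simp add: power2_eq_square)
    also have "\<dots> = grad f x \<bullet> ?V x" using V1 V2 xC by blast
    also have "\<dots> \<le> norm (grad f x) * norm (?V x)" by (rule norm_cauchy_schwarz)
    finally have *: "c/2 * norm (?V x) \<le> norm (grad f x)"
      by (cases "?V x = 0") auto
    have "norm (grad f x) \<le> norm (grad f p) + norm (grad f x - grad f p)"
      by (metis norm_triangle_ineq add.commute diff_add_cancel)
    also have "\<dots> \<le> norm (grad f p) + L2 * r"
      using Lg'[OF x, of p] x r(1) L12
      by (smt (verit) centre_in_ball dist_norm mem_ball mult_left_mono norm_minus_commute)
    finally have "c/2 * norm (?V x) \<le> norm (grad f p) + L2 * r" using * by linarith
    then show ?thesis using c(1) by (simp add: M_def field_simps)
  qed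
  have "((L2 + L1 * M) * (2 / c))-lipschitz_on (ball p r) ?V"
  proof (rule lipschitz_onI)
    show "0 \<le> (L2 + L1 * M) * (2 / c)" using L12 M0 c(1) by simp
    fix x y assume x: "x \<in> ball p r" and y: "y \<in> ball p r"
    have xC: "x \<in> C" "y \<in> C" using x y sub by blast+
    define d where "d = ?V x - ?V y"
    have Ad: "A *v d = 0" using V1[OF xC(1)] V1[OF xC(2)] by (simp add: d_def matrix_vector_mult_diff_distrib)
    \<comment> \<open>Since \<open>d\<close> is in ker A, the first two terms on the right become
      differentials of \<open>f\<close>; the third accounts for the change of metric between
      \<open>x\<close> and \<open>y\<close>.\<close>
    have "(H x *v d) \<bullet> d = (H x *v ?V x) \<bullet> d - (H y *v ?V y) \<bullet> d - ((H x - H y) *v ?V y) \<bullet> d"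
      by (simp add: d_def matrix_vector_mult_diff_distrib matrix_vector_mult_diff_rdistrib inner_diff_left)
    also have "\<dots> = (grad f x - grad f y) \<bullet> d - ((H x - H y) *v ?V y) \<bullet> d"
      using V2[OF xC(1) Ad] V2[OF xC(2) Ad] by (simp add: inner_diff_left)
    also have "\<dots> \<le> norm (grad f x - grad f y) * norm d + norm ((H x - H y) *v ?V y) * norm d"
      using norm_cauchy_schwarz[of "grad f x - grad f y" d] Cauchy_Schwarz_ineq2[of "(H x - H y) *v ?V y" d]
      by linarith
    also have "\<dots> \<le> (L2 * norm (x - y)) * norm d + (L1 * norm (x - y) * M) * norm d"
    proof -
      have "norm ((H x - H y) *v ?V y) \<le> norm (H x - H y) * norm (?V y)" by (rule norm_matrix_vector_mult_le)
      also have "\<dots> \<le> (L1 * norm (x - y)) * M"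
        using LH'[OF x y] VM[OF y] L12 by (intro mult_mono) auto
      finally show ?thesis using Lg'[OF x y] by (intro add_mono mult_right_mono) auto
    qed
    also have "\<dots> = ((L2 + L1 * M) * norm (x - y)) * norm d" by (simp add: algebra_simps)
    finally have "c/2 * norm d * norm d \<le> ((L2 + L1 * M) * norm (x - y)) * norm d"
      using coer[OF x, of d] by (simp add: power2_eq_square)
    then have "c/2 * norm d \<le> (L2 + L1 * M) * norm (x - y)"
      using L12 M0 by (cases "d = 0") auto
    then show "dist (?V x) (?V y) \<le> (L2 + L1 * M) * (2 / c) * dist x y"
      using c(1) by (simp add: d_def dist_norm field_simps)
  qed
  then show thesis using that r(1) sub(1) by blast
qed

section \<open>Uniqueness for Lipschitz differential equations\<close>

text \<open>Gronwall's argument in energy form: the squared distance has derivative at most 2 L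
  times itself, so multiplied by exp (- 2 L t) it is nonincreasing, and it starts at 0.\<close>

lemma ode_unique_forward:
  fixes x y :: "real \<Rightarrow> 'a::real_inner"
  assumes ab: "a \<le> b" and L: "L-lipschitz_on B W"
    and c: "continuous_on {a..b} x" "continuous_on {a..b} y"
    and D: "\<And>t. t \<in> {a<..<b} \<Longrightarrow> (x has_vector_derivative W (x t)) (at t)"
      "\<And>t. t \<in> {a<..<b} \<Longrightarrow> (y has_vector_derivative W (y t)) (at t)"
    and B: "\<And>t. t \<in> {a<..<b} \<Longrightarrow> x t \<in> B \<and> y t \<in> B"
    and eq: "x a = y a"
  shows "x b = y b"
proof -
  define E where "E t = exp (- (2 * L * t)) * ((x t - y t) \<bullet> (x t - y t))" for t
  have "E b \<le> E a"
  proof (rule DERIV_nonpos_imp_decreasing_open[OF ab])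
    fix t assume t: "a < t" "t < b"
    let ?z = "x t - y t" and ?w = "W (x t) - W (y t)"
    have "((\<lambda>t. x t - y t) has_vector_derivative ?w) (at t)"
      using D t by (intro has_vector_derivative_diff) auto
    then have "((\<lambda>t. (x t - y t) \<bullet> (x t - y t)) has_vector_derivative ?z \<bullet> ?w + ?w \<bullet> ?z) (at t)"
      by (intro bounded_bilinear.has_vector_derivative[OF bounded_bilinear_inner])
    then have "((\<lambda>t. (x t - y t) \<bullet> (x t - y t)) has_real_derivative 2 * (?z \<bullet> ?w)) (at t)"
      by (simp add: has_real_derivative_iff_has_vector_derivative inner_commute[of ?w])
    then have "(E has_real_derivative
        exp (- (2 * L * t)) * (2 * (?z \<bullet> ?w)) + exp (- (2 * L * t)) * (- (2 * L)) * (?z \<bullet> ?z)) (at t)"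
      unfolding E_def by (auto intro!: derivative_eq_intros)
    moreover have "?z \<bullet> ?w \<le> L * (?z \<bullet> ?z)"
    proof -
      have "?z \<bullet> ?w \<le> norm ?z * norm ?w" by (rule norm_cauchy_schwarz)
      also have "\<dots> \<le> norm ?z * (L * norm ?z)"
        using lipschitz_onD[OF L] B t by (intro mult_left_mono) (auto simp: dist_norm)
      finally show ?thesis by (simp add: power2_norm_eq_inner[symmetric] power2_eq_square mult_ac)
    qed
    then have "exp (- (2 * L * t)) * (2 * (?z \<bullet> ?w) - 2 * L * (?z \<bullet> ?z)) \<le> 0"
      by (simp add: mult_le_0_iff)
    then have "exp (- (2 * L * t)) * (2 * (?z \<bullet> ?w)) + exp (- (2 * L * t)) * (- (2 * L)) * (?z \<bullet> ?z) \<le> 0"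
      by (simp add: algebra_simps)
    ultimately show "\<exists>m. (E has_real_derivative m) (at t) \<and> m \<le> 0" by blast
  next
    show "continuous_on {a..b} E" unfolding E_def by (intro continuous_intros c)
  qed
  then have "(x b - y b) \<bullet> (x b - y b) \<le> 0" using eq by (simp add: E_def mult_le_0_iff)
  then have "(x b - y b) \<bullet> (x b - y b) = 0" by (intro antisym) auto
  then show ?thesis by simp
qed

lemma ode_unique_local:
  fixes x y :: "real \<Rightarrow> 'a::real_inner"
  assumes L: "L-lipschitz_on B W"
    and c: "continuous_on {a..b} x" "continuous_on {a..b} y"
    and D: "\<And>t. t \<in> {a<..<b} \<Longrightarrow> (x has_vector_derivative W (x t)) (at t)"
      "\<And>t. t \<in> {a<..<b} \<Longrightarrow> (y has_vector_derivative W (y t)) (at t)"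
    and B: "\<And>t. t \<in> {a<..<b} \<Longrightarrow> x t \<in> B \<and> y t \<in> B"
    and p: "p \<in> {a..b}" "x p = y p" and t: "t \<in> {a..b}"
  shows "x t = y t"
proof (cases "p \<le> t")
  case True
  show ?thesis
    by (rule ode_unique_forward[OF True L]) (use assms in \<open>auto elim!: continuous_on_subset\<close>)
next
  case False
  \<comment> \<open>Times before \<open>p\<close> are reached by reversing time, which replaces the
    field by its negative and keeps its Lipschitz constant.\<close>
  define X Y where "X s = x (- s)" and "Y s = y (- s)" for s
  have L': "L-lipschitz_on B (\<lambda>z. - W z)" using L by (simp add: lipschitz_on_minus)
  have "X (- t) = Y (- t)"
  proof (rule ode_unique_forward[OF _ L'])
    show "- p \<le> - t" using False by simp
    show "continuous_on {- p..- t} X" "continuous_on {- p..- t} Y"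
      unfolding X_def Y_def using p t
      by (auto intro!: continuous_on_compose2[OF c(1)] continuous_on_compose2[OF c(2)] continuous_intros)
    fix s assume s: "s \<in> {- p<..<- t}"
    then have s': "- s \<in> {a<..<b}" using p t by auto
    have m: "((\<lambda>s. - s) has_vector_derivative - 1) (at s)" by (auto intro!: derivative_eq_intros)
    show "(X has_vector_derivative - W (X s)) (at s)" "(Y has_vector_derivative - W (Y s)) (at s)"
      unfolding X_def Y_def
      using vector_diff_chain_at[OF m D(1)[OF s']] vector_diff_chain_at[OF m D(2)[OF s']]
      by (simp_all add: o_def)
    show "X s \<in> B \<and> Y s \<in> B" using B s' by (simp add: X_def Y_def)
  qed (use p in \<open>simp add: X_def Y_def\<close>)
  then show ?thesis by (simp add: X_def Y_def)
qed

text \<open>Continuity of \<open>x\<close> brings the expansion of \<open>G\<close> at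
  \<open>x t\<close> into play. The lower bound on \<open>L\<close> first yields norm (x s - x t)
  \<le> M * |s - t| near \<open>t\<close>; then the remainder of \<open>G\<close> is small relative
  to |s - t|, and the lower bound is applied once more.\<close>

lemma has_vector_derivative_of_comp:
  fixes G :: "'a::real_normed_vector \<Rightarrow> 'b::real_normed_vector" and x :: "real \<Rightarrow> 'a"
  assumes G: "(G has_derivative L) (at (x t))" and c: "0 < c" "\<And>u. c * norm u \<le> norm (L u)"
    and x: "isCont x t" and D: "((\<lambda>s. G (x s)) has_vector_derivative L q) (at t)"
  shows "(x has_vector_derivative q) (at t)"
proof -
  let ?p = "x t"
  have linL: "linear L" using G has_derivative_linear by blast
  have near: "\<exists>d>0. \<forall>s. \<bar>s - t\<bar> < d \<longrightarrow> norm (G (x s) - G ?p - L (x s - ?p)) \<le> e * norm (x s - ?p)"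
    if "0 < e" for e
  proof -
    obtain d where d: "0 < d" "\<And>y. norm (y - ?p) < d \<Longrightarrow> norm (G y - G ?p - L (y - ?p)) \<le> e * norm (y - ?p)"
      using G \<open>0 < e\<close> unfolding has_derivative_at_alt by blast
    obtain d' where "0 < d'" "\<And>s. dist s t < d' \<Longrightarrow> dist (x s) ?p < d"
      using x d(1) unfolding continuous_at_eps_delta by blast
    then show ?thesis using d(2) by (intro exI[of _ d']) (auto simp: dist_norm)
  qed
  have Dnear: "\<exists>d>0. \<forall>s. \<bar>s - t\<bar> < d \<longrightarrow> norm (G (x s) - G ?p - (s - t) *\<^sub>R L q) \<le> e * \<bar>s - t\<bar>"
    if "0 < e" for e
    using D that unfolding has_vector_derivative_def has_derivative_at_alt by auto
  \<comment> \<open>The remainder of \<open>G\<close>, at most c/2 times the increment of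
    \<open>x\<close>, is absorbed on the left; the increment of \<open>G \<circ> x\<close> is at
    most (norm (L q) + 1) * |s - t|.\<close>
  define M where "M = 2 / c * (norm (L q) + 1)"
  have M: "0 < M" using c(1) by (simp add: M_def add_nonneg_pos)
  have Lb: "\<exists>d>0. \<forall>s. \<bar>s - t\<bar> < d \<longrightarrow> norm (x s - ?p) \<le> M * \<bar>s - t\<bar>"
  proof -
    obtain d1 where d1: "0 < d1" "\<And>s. \<bar>s - t\<bar> < d1 \<Longrightarrow> norm (G (x s) - G ?p - L (x s - ?p)) \<le> c/2 * norm (x s - ?p)"
      using near[of "c/2"] c(1) by auto
    obtain d2 where d2: "0 < d2" "\<And>s. \<bar>s - t\<bar> < d2 \<Longrightarrow> norm (G (x s) - G ?p - (s - t) *\<^sub>R L q) \<le> 1 * \<bar>s - t\<bar>"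
      using Dnear[of 1] by auto
    have "norm (x s - ?p) \<le> M * \<bar>s - t\<bar>" if s: "\<bar>s - t\<bar> < min d1 d2" for s
    proof -
      let ?g = "G (x s) - G ?p" and ?u = "x s - ?p"
      have "norm (L ?u) \<le> norm ?g + norm (?g - L ?u)"
        by (metis norm_triangle_ineq4 norm_minus_commute diff_diff_eq2 add_diff_cancel_left' add_diff_cancel)
      moreover have "norm ?g \<le> norm (?g - (s - t) *\<^sub>R L q) + norm ((s - t) *\<^sub>R L q)"
        by (metis norm_triangle_ineq diff_add_cancel)
      moreover have "norm ((s - t) *\<^sub>R L q) = \<bar>s - t\<bar> * norm (L q)" by simp
      ultimately have "c/2 * norm ?u \<le> \<bar>s - t\<bar> + \<bar>s - t\<bar> * norm (L q)"
        using d1(2)[of s] d2(2)[of s] s c(2)[of ?u] by auto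
      then show ?thesis using c(1) by (simp add: M_def field_simps)
    qed
    then show ?thesis using d1(1) d2(1) by (intro exI[of _ "min d1 d2"]) auto
  qed
  show ?thesis
    unfolding has_vector_derivative_def has_derivative_at_alt
  proof (intro conjI allI impI)
    show "bounded_linear (\<lambda>h. h *\<^sub>R q)" by (rule bounded_linear_scaleR_left)
    fix e :: real assume e: "0 < e"
    obtain d1 where d1: "0 < d1" "\<And>s. \<bar>s - t\<bar> < d1 \<Longrightarrow> norm (x s - ?p) \<le> M * \<bar>s - t\<bar>"
      using Lb by blast
    \<comment> \<open>Each of the two errors is to contribute e * c / 2 * |s - t|; the lower bound
      on \<open>L\<close> then cancels \<open>c\<close>.\<close>
    have "0 < e * c / (2 * M)" using e c(1) M by simp
    then obtain d2 where d2: "0 < d2" "\<And>s. \<bar>s - t\<bar> < d2 \<Longrightarrow>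
        norm (G (x s) - G ?p - L (x s - ?p)) \<le> e * c / (2 * M) * norm (x s - ?p)"
      using near by blast
    have "0 < e * c / 2" using e c(1) by simp
    then obtain d3 where d3: "0 < d3" "\<And>s. \<bar>s - t\<bar> < d3 \<Longrightarrow>
        norm (G (x s) - G ?p - (s - t) *\<^sub>R L q) \<le> e * c / 2 * \<bar>s - t\<bar>"
      using Dnear by blast
    have "norm (x s - ?p - (s - t) *\<^sub>R q) \<le> e * norm (s - t)" if s: "\<bar>s - t\<bar> < min d1 (min d2 d3)" for s
    proof -
      let ?g = "G (x s) - G ?p" and ?u = "x s - ?p"
      have "c * norm (?u - (s - t) *\<^sub>R q) \<le> norm (L (?u - (s - t) *\<^sub>R q))" by (rule c)
      also have "L (?u - (s - t) *\<^sub>R q) = (?g - (s - t) *\<^sub>R L q) - (?g - L ?u)"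
        using linL by (simp add: linear_diff linear_cmul)
      also have "norm \<dots> \<le> norm (?g - (s - t) *\<^sub>R L q) + norm (?g - L ?u)" by (rule norm_triangle_ineq4)
      also have "\<dots> \<le> e * c / 2 * \<bar>s - t\<bar> + e * c / (2 * M) * (M * \<bar>s - t\<bar>)"
      proof (rule add_mono)
        have "norm (?g - L ?u) \<le> e * c / (2 * M) * norm ?u" using d2(2) s by simp
        also have "\<dots> \<le> e * c / (2 * M) * (M * \<bar>s - t\<bar>)"
          using d1(2)[of s] s e c(1) M by (intro mult_left_mono) auto
        finally show "norm (?g - L ?u) \<le> e * c / (2 * M) * (M * \<bar>s - t\<bar>)" .
      qed (use d3(2) s in simp)
      also have "\<dots> = c * (e * \<bar>s - t\<bar>)" using M by (simp add: field_simps)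
      finally show ?thesis using c(1) by simp
    qed
    then show "\<exists>d>0. \<forall>s. norm (s - t) < d \<longrightarrow> norm (x s - x t - (s - t) *\<^sub>R q) \<le> e * norm (s - t)"
      using d1(1) d2(1) d3(1) by (intro exI[of _ "min d1 (min d2 d3)"]) auto
  qed
qed

section \<open>The differential inclusion\<close>

text \<open>\<open>G\<close> stands for the gradient of \<open>h\<close> and \<open>H\<close> for
  its Hessian, so the argument runs on real vector fields instead of extended-valued
  functions.\<close>

locale hessian_riemannian =
  fixes A :: "real^'n^'m" and C :: "(real^'n) set" and f :: "real^'n \<Rightarrow> real"
    and G :: "real^'n \<Rightarrow> real^'n" and H :: "real^'n \<Rightarrow> real^'n^'n"
  assumes full_rank: "rank A = CARD('m)"
    and open_C: "open C"
    and G_deriv: "x \<in> C \<Longrightarrow> (G has_derivative (*v) (H x)) (at x)"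
    and pos_def: "x \<in> C \<Longrightarrow> sym_pos_def (H x)"
    and lipschitz_H: "locally_lipschitz_on C H"
    and lipschitz_f: "locally_lipschitz_on UNIV (grad f)"
begin

abbreviation "V \<equiv> HR_grad A H f"

lemma V_lipschitz:
  assumes "p \<in> C"
  obtains r L where "0 < r" "ball p r \<subseteq> C" "L-lipschitz_on (ball p r) V"
  using HR_grad_lipschitz[OF full_rank open_C pos_def lipschitz_H lipschitz_f assms] by blast

lemma V_continuous: "continuous_on C V"
proof (rule continuous_at_imp_continuous_on, rule ballI)
  fix p assume "p \<in> C"
  then obtain r L where r: "0 < r" and "L-lipschitz_on (ball p r) V" by (rule V_lipschitz)
  then have "continuous_on (ball p r) V" by (rule_tac lipschitz_on_continuous_on)
  then show "isCont V p" using r continuous_on_eq_continuous_at[OF open_ball] centre_in_ball by blast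
qed

lemma G_comp_derivative:
  assumes "x t \<in> C" and x: "(x has_vector_derivative q) (at t)"
  shows "((\<lambda>s. G (x s)) has_vector_derivative H (x t) *v q) (at t)"
  using has_derivative_compose[OF x[unfolded has_vector_derivative_def] G_deriv[OF assms(1)]]
  unfolding has_vector_derivative_def by (simp add: matrix_vector_mult_scaleR)

text \<open>As \<open>G\<close> has an invertible derivative, differentiability of \<open>G \<circ> x\<close> at \<open>t\<close> is inherited by \<open>x\<close>.\<close>

lemma derivative_of_inclusion:
  assumes J: "open J" "t \<in> J" and x: "continuous_on J x" "x t \<in> C"
    and aff: "\<And>s. s \<in> J \<Longrightarrow> A *v x s = b"
    and D: "((\<lambda>s. G (x s)) has_vector_derivative D) (at t)"
      "D + grad f (x t) \<in> range ((*v) (transpose A))"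
  shows "(x has_vector_derivative - V (x t)) (at t)"
proof -
  have pd: "sym_pos_def (H (x t))" using pos_def x(2) .
  \<comment> \<open>If \<open>x\<close> has a derivative at \<open>t\<close>, the chain rule forces
    it to be this vector.\<close>
  define q where "q = matrix_inv (H (x t)) *v D"
  have Hq: "H (x t) *v q = D"
    unfolding q_def by (rule matrix_inv_mult(1)[OF sym_pos_def_invertible[OF pd]])
  obtain c where c: "0 < c" "\<And>u. c * (norm u)\<^sup>2 \<le> (H (x t) *v u) \<bullet> u"
    using sym_pos_def_coercive[OF pd] by blast
  have cn: "c * norm u \<le> norm (H (x t) *v u)" for u
  proof (cases "u = 0")
    case False
    have "c * norm u * norm u \<le> norm (H (x t) *v u) * norm u"
      using c(2)[of u] norm_cauchy_schwarz[of "H (x t) *v u" u] by (simp add: power2_eq_square)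
    then show ?thesis using False by simp
  qed simp
  have xq: "(x has_vector_derivative q) (at t)"
  proof (rule has_vector_derivative_of_comp[where G=G and L="(*v) (H (x t))"])
    show "isCont x t" using x(1) J continuous_on_eq_continuous_at by blast
    show "((\<lambda>s. G (x s)) has_vector_derivative H (x t) *v q) (at t)" using D(1) Hq by simp
  qed (use G_deriv x(2) c(1) cn in auto)
  have "((\<lambda>s. A *v x s) has_vector_derivative A *v q) (at t)"
    using bounded_linear.has_vector_derivative[OF matrix_vector_mul_bounded_linear xq] .
  moreover have "((\<lambda>s. A *v x s) has_vector_derivative 0) (at t)"
    by (rule has_vector_derivative_transform_within_open[of "\<lambda>_. b" _ _ J]) (use J aff in auto)
  ultimately have "A *v q = 0" using vector_derivative_unique_at by blast
  then have "q = - V (x t)"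
    using HR_grad_unique[OF full_rank, of H "x t" q f] pd D(2) Hq by simp
  then show ?thesis using xq by simp
qed

lemma inclusion_unique:
  assumes J: "open J" "is_interval J" "t0 \<in> J"
    and y: "\<And>t. t \<in> J \<Longrightarrow> y t \<in> C" "\<And>t. t \<in> J \<Longrightarrow> (y has_vector_derivative - V (y t)) (at t)"
    and x: "x \<in> W11_loc J" and eq: "x t0 = y t0"
    and incl: "AE t\<in>J in lebesgue. \<exists>D. ((\<lambda>s. G (x s)) has_vector_derivative D) (at t) \<and>
      D + grad f (x t) \<in> range ((*v) (transpose A))"
    and feas: "AE t\<in>J in lebesgue. x t \<in> feasible_set C A b"
    and t: "t \<in> J"
  shows "x t = y t"
proof -
  obtain v where cx: "continuous_on J x" and v: "locally_integrable_on v J" "has_weak_derivative_on x v J"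
    using x unfolding W11_loc_def by blast
  have cy: "continuous_on J y"
    using y(2) by (meson continuous_at_imp_continuous_on has_vector_derivative_continuous)
  \<comment> \<open>The affine constraint is a closed condition, so by continuity it passes from
    almost every time to every time; membership in the open set \<open>C\<close> does not.\<close>
  have aff: "A *v x s = b" if "s \<in> J" for s
  proof (rule AE_eq_const_imp_eq[OF J(1) _ _ that])
    show "continuous_on J (\<lambda>s. A *v x s)"
      using cx by (intro continuous_on_compose2[OF matrix_vector_mult_linear_continuous_on[of UNIV]]) auto
    show "AE s\<in>J in lebesgue. A *v x s = b"
      using feas by eventually_elim (auto simp: feasible_set_def)
  qed
  have "AE t\<in>J in lebesgue. (x has_vector_derivative - V (x t)) (at t)"
    using incl feas
  proof eventually_elim
    case (elim t)
    show ?case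
    proof
      assume t: "t \<in> J"
      then have "x t \<in> C" using elim(2) by (auto simp: feasible_set_def)
      then show "(x has_vector_derivative - V (x t)) (at t)"
        using derivative_of_inclusion[OF J(1) t cx _ aff] elim(1) t by blast
    qed
  qed
  then obtain N where N: "N \<in> null_sets lebesgue"
      "{t \<in> space lebesgue. \<not> (t \<in> J \<longrightarrow> (x has_vector_derivative - V (x t)) (at t))} \<subseteq> N"
    unfolding eventually_ae_filter by blast
  have negl: "negligible N" using N(1) negligible_iff_null_sets by blast
  have Dx: "(x has_vector_derivative - V (x t)) (at t)" if "t \<in> J - N" for t
    using N(2) that by auto
  define E where "E = {t \<in> J. x t - y t = 0}"
  have "closedin (top_of_set J) E"
    unfolding E_def by (intro continuous_closedin_preimage_constant continuous_on_diff cx cy)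
  moreover have "openin (top_of_set J) E"
  proof -
    have "\<exists>\<delta>>0. ball p \<delta> \<subseteq> E" if p: "p \<in> E" for p
    proof -
      have pJ: "p \<in> J" and xy: "x p = y p" using p by (auto simp: E_def)
      obtain r L where r: "0 < r" "ball (y p) r \<subseteq> C" "L-lipschitz_on (ball (y p) r) V"
        using V_lipschitz[OF y(1)[OF pJ]] by blast
      \<comment> \<open>As \<open>y p\<close> lies in \<open>C\<close> and the curves agree at
        \<open>p\<close>, continuity keeps both inside one ball on which \<open>V\<close> is
        Lipschitz.\<close>
      have "open (J \<inter> x -` ball (y p) r)" "open (J \<inter> y -` ball (y p) r)"
        using J(1) cx cy by (auto intro!: continuous_open_preimage)
      then have "open ((J \<inter> x -` ball (y p) r) \<inter> (J \<inter> y -` ball (y p) r))" by blast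
      moreover have "p \<in> (J \<inter> x -` ball (y p) r) \<inter> (J \<inter> y -` ball (y p) r)"
        using pJ xy r(1) by simp
      ultimately obtain \<delta> where \<delta>: "0 < \<delta>"
          "cball p \<delta> \<subseteq> (J \<inter> x -` ball (y p) r) \<inter> (J \<inter> y -` ball (y p) r)"
        using open_contains_cball by meson
      define a b where "a = p - \<delta>" and "b = p + \<delta>"
      have I: "{a..b} = cball p \<delta>" by (simp add: a_def b_def cball_eq_atLeastAtMost)
      have sub: "{a..b} \<subseteq> J" and B: "\<And>t. t \<in> {a..b} \<Longrightarrow> x t \<in> ball (y p) r \<and> y t \<in> ball (y p) r"
        using \<delta>(2) unfolding I by auto
      have cxI: "continuous_on {a..b} x" and cyI: "continuous_on {a..b} y"
        using cx cy sub continuous_on_subset by blast+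
      \<comment> \<open>On {a..b} the curve \<open>x\<close> stays in \<open>C\<close>, so its
        almost everywhere derivative - V (x t) depends continuously on time and hence is attained at
        every interior time.\<close>
      have Dx': "(x has_vector_derivative - V (x t)) (at t)" if "t \<in> {a<..<b}" for t
      proof (rule ae_derivative_imp_derivative[where v=v and N=N and g="\<lambda>t. - V (x t)", OF _ _ _ negl _ that])
        show "v absolutely_integrable_on {a..b}"
          using v(1) sub unfolding locally_integrable_on_def by blast
        show "x t - x s = integral {s..t} v" if "a \<le> s" "s \<le> t" "t \<le> b" for s t
          by (rule weak_derivative_imp_integral[OF J(1) cx v]) (use that sub in auto)
        show "continuous_on {a..b} (\<lambda>t. - V (x t))"
          using cxI B r(2) by (intro continuous_on_minus continuous_on_compose2[OF V_continuous]) auto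
        show "(x has_vector_derivative - V (x t)) (at t)" if "t \<in> {a..b} - N" for t
          using Dx that sub by blast
      qed
      have L: "L-lipschitz_on (ball (y p) r) (\<lambda>z. - V z)" using r(3) by (simp add: lipschitz_on_minus)
      have "x t = y t" if "t \<in> {a..b}" for t
      proof (rule ode_unique_local[where x=x and y=y and W="\<lambda>z. - V z" and p=p, OF L cxI cyI Dx'])
        show "(y has_vector_derivative - V (y t)) (at t)" if "t \<in> {a<..<b}" for t
          using y(2)[of t] subsetD[OF sub, of t] that by simp
      qed (use B xy that \<delta>(1) in \<open>auto simp: a_def b_def\<close>)
      then have "ball p \<delta> \<subseteq> E" using sub ball_subset_cball I by (fastforce simp: E_def)
      then show ?thesis using \<delta>(1) by blast
    qed
    then have "open E" using open_contains_ball by blast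
    then show ?thesis using J(1) by (simp add: openin_open_eq E_def subset_iff)
  qed
  moreover have "connected J" using J(2) is_interval_connected by blast
  ultimately have "E = {} \<or> E = J" unfolding connected_clopen by blast
  then have "E = J" using J(3) eq by (auto simp: E_def)
  then show ?thesis using t by (auto simp: E_def)
qed

end

theorem proposition3p1:
  fixes A :: "real^'n^'m" and b :: "real^'m" and C :: "(real^'n) set"
    and f :: "real^'n \<Rightarrow> real" and h :: "real^'n \<Rightarrow> ereal" and H :: "real^'n \<Rightarrow> real^'n^'n"
    and x0 :: "real^'n" and Tm TM :: ereal and xmax :: "real \<Rightarrow> real^'n"
  assumes "CARD('m) < CARD('n)"
    and "rank A = CARD('m)"
    and "b \<in> range ((*v) A)"
    and "C \<noteq> {}" and "open C" and "convex C"
    and "feasible_set C A b \<noteq> {}"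
    and "C1_on UNIV f" and "locally_lipschitz_on UNIV (grad f)"
    and "h \<in> Gamma0"
    and "legendre_type h" and "interior (eff_dom h) = C"
    and "H = hess (\<lambda>y. real_of_ereal (h y))"
    and "C2_on C (\<lambda>y. real_of_ereal (h y))"
    and "\<forall>x\<in>C. sym_pos_def (H x)"
    and "locally_lipschitz_on C H"
    and "x0 \<in> feasible_set C A b"
    and "maximal_cauchy_solution (feasible_set C A b) (HR_grad A H f) x0 Tm TM xmax"
  shows "(\<forall>x \<in> W11_loc (einterval Tm TM).
            inclusion_solution C A b f h x0 (einterval Tm TM) x \<longleftrightarrow>
            (\<forall>t\<in>einterval Tm TM. x t = xmax t)) \<and>
         (\<exists>x \<in> W11_loc (einterval Tm TM).
            inclusion_solution C A b f h x0 (einterval Tm TM) x \<and>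
            x C1_differentiable_on einterval Tm TM \<and>
            (\<forall>y \<in> W11_loc (einterval Tm TM).
               inclusion_solution C A b f h x0 (einterval Tm TM) y \<longrightarrow>
               (\<forall>t\<in>einterval Tm TM. y t = x t)))"
proof -
  let ?g = "\<lambda>y. real_of_ereal (h y)"
  define J where "J = einterval Tm TM"
  \<comment> \<open>\<open>H\<close> is the Jacobian matrix of the gradient, which represents its
    derivative on \<open>C\<close> because the gradient is differentiable there.\<close>
  interpret hessian_riemannian A C f "grad ?g" H
  proof
    fix x assume "x \<in> C"
    then have "grad ?g differentiable at x" using assms(14) unfolding C2_on_def by blast
    then show "(grad ?g has_derivative (*v) (H x)) (at x)"
      unfolding assms(13) hess_def by (simp add: jacobian_works[symmetric])
  qed (use assms in auto)
  have sol: "Tm < 0" "0 < TM" "xmax 0 = x0" "\<And>t. t \<in> J \<Longrightarrow> xmax t \<in> feasible_set C A b"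
      "\<And>t. t \<in> J \<Longrightarrow> (xmax has_vector_derivative - V (xmax t)) (at t)"
    using assms(18) unfolding maximal_cauchy_solution_def cauchy_solution_def J_def
    by (auto simp: eq_neg_iff_add_eq_0[symmetric])
  have "r \<in> J" if "p \<in> J" "q \<in> J" "p \<le> r" "r \<le> q" for p q r
  proof -
    have "Tm < ereal p" "ereal p \<le> ereal r" "ereal r \<le> ereal q" "ereal q < TM"
      using that by (auto simp: J_def einterval_iff)
    then show ?thesis
      unfolding J_def einterval_iff by (meson less_le_trans le_less_trans)
  qed
  then have "is_interval J" unfolding is_interval_1 by blast
  moreover have "0 \<in> J" using sol(1,2) by (simp add: J_def einterval_iff zero_ereal_def[symmetric])
  ultimately have J: "open J" "is_interval J" "0 \<in> J" by (auto simp: J_def)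
  have C: "xmax t \<in> C" if "t \<in> J" for t using sol(4)[OF that] by (simp add: feasible_set_def)
  have cxmax: "continuous_on J xmax"
    using sol(5) by (meson continuous_at_imp_continuous_on has_vector_derivative_continuous)
  have c': "continuous_on J (\<lambda>t. - V (xmax t))"
    using C by (intro continuous_on_minus continuous_on_compose2[OF V_continuous cxmax]) auto
  have "J \<noteq> {}" using J(3) by blast
  from C1_imp_W11_loc[OF J(1,2) this sol(5) c'] have W: "xmax \<in> W11_loc J" .
  have C1: "xmax C1_differentiable_on J"
    unfolding C1_differentiable_on_def using sol(5) c' by (intro exI[of _ "\<lambda>t. - V (xmax t)"]) simp
  \<comment> \<open>Stated for every curve that agrees with \<open>xmax\<close> on \<open>J\<close>,
    because values outside \<open>J\<close> are arbitrary. Openness of \<open>J\<close> transfers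
    the derivative as well.\<close>
  have incl: "inclusion_solution C A b f h x0 J x" if x: "\<forall>t\<in>J. x t = xmax t" for x
    unfolding inclusion_solution_def
  proof (intro conjI)
    show "x 0 = x0" using x J(3) sol(3) by simp
    show "AE t\<in>J in lebesgue. x t \<in> feasible_set C A b" using x sol(4) by (intro AE_I2) simp
    have "\<exists>D. ((\<lambda>s. grad ?g (x s)) has_vector_derivative D) (at t) \<and>
        D + grad f (x t) \<in> range ((*v) (transpose A))" if t: "t \<in> J" for t
    proof -
      have xC: "x t \<in> C" using x t C by simp
      have "(x has_vector_derivative - V (x t)) (at t)"
        by (rule has_vector_derivative_transform_within_open[of xmax _ _ J]) (use x t J(1) sol(5)[OF t] in auto)
      then have "((\<lambda>s. grad ?g (x s)) has_vector_derivative H (x t) *v (- V (x t))) (at t)"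
        by (rule G_comp_derivative[where x=x, OF xC])
      moreover have "H (x t) *v (- V (x t)) + grad f (x t) \<in> range ((*v) (transpose A))"
        using HR_grad_unique[where H=H and x="x t" and p="- V (x t)" and f=f, OF full_rank pos_def[OF xC]] by simp
      ultimately show ?thesis by blast
    qed
    then show "AE t\<in>J in lebesgue. \<exists>D. ((\<lambda>s. grad ?g (x s)) has_vector_derivative D) (at t) \<and>
        D + grad f (x t) \<in> range ((*v) (transpose A))"
      by (intro AE_I2) blast
  qed
  have uniq: "x t = xmax t" if "x \<in> W11_loc J" "inclusion_solution C A b f h x0 J x" "t \<in> J" for x t
    using that(2) sol(3) unfolding inclusion_solution_def
    by (intro inclusion_unique[OF J C sol(5) that(1) _ _ _ that(3)]) auto
  show ?thesis
    unfolding J_def[symmetric] using incl uniq W C1 by blast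
qed

end
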